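(* A unital simple TAI $C^*$-algebra has stable rank one.
   Context: $\mathcal I$ denotes the class of all unital $C^*$-algebras of the form $\bigoplus_{i=1}^n B_i$ (finite direct sum), where each $B_i\cong M_k$ or $B_i\cong M_k(C([0,1]))$ for some integer $k$. For projections, $p\preceq q$ means $p$ is Murray–von Neumann equivalent to a projection in $qAq$; $[p]$ is the equivalence class of $p$; for $a\in A_+$, $p\preceq a$ means $p\preceq q$ for some projection $q\in\overline{aAa}$. An element is full if the closed ideal it generates is $A$. $x\in_\varepsilon S$ means there is $y\in S$ with $\|x-y\|<\varepsilon$. A unital $C^*$-algebra $A$ is tracially AI (TAI) if for any finite subset $\mathcal F\subset A$ containing a nonzero element $b$, any $\varepsilon>0$, any integer $n>0$ and any full element $a\in A_+$, there exist a nonzero projection $p\in A$ and a $C^*$-subalgebra $I\subset A$ with $I\in\mathcal I$ and $1_I=p$ such that (1) $\|xp-px\|<\varepsilon$ for all $x\in\mathcal F$; (2) $pxp\in_\varepsilon I$ for all $x\in\mathcal F$ and $\|pbp\|\ge\|b\|-\varepsilon$; (3) $n[1-p]\le[p]$ and $1-p\preceq a$. A unital $C^*$-algebra has stable rank one if its invertible elements are norm dense. *)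

theory Defs
  imports "HOL-Analysis.Analysis" "Jordan_Normal_Form.Matrix"
begin

section \<open>Unital C*-algebras\<close>

text \<open>
  Nonzero unital complex C*-algebras, as a type class. The compatible real structure comes from
  \<^class>\<open>real_normed_algebra_1\<close>, which also gives submultiplicativity of the norm and
  excludes the zero algebra; its axiom that the unit has norm 1 follows from the C*-identity.
\<close>

class unital_cstar_algebra = real_normed_algebra_1 + banach +
  fixes scaleC :: "complex \<Rightarrow> 'a \<Rightarrow> 'a"  (infixr \<open>*\<^sub>C\<close> 75)
    and adj :: "'a \<Rightarrow> 'a"
  assumes scaleC_add_right: "c *\<^sub>C (x + y) = c *\<^sub>C x + c *\<^sub>C y"
    and scaleC_add_left: "(c + d) *\<^sub>C x = c *\<^sub>C x + d *\<^sub>C x"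
    and scaleC_scaleC: "c *\<^sub>C d *\<^sub>C x = (c * d) *\<^sub>C x"
    and scaleR_scaleC: "r *\<^sub>R x = complex_of_real r *\<^sub>C x"
    and mult_scaleC_left: "(c *\<^sub>C x) * y = c *\<^sub>C (x * y)"
    and mult_scaleC_right: "x * (c *\<^sub>C y) = c *\<^sub>C (x * y)"
    and norm_scaleC: "norm (c *\<^sub>C x) = cmod c * norm x"
    and adj_adj: "adj (adj x) = x"
    and adj_add: "adj (x + y) = adj x + adj y"
    and adj_scaleC: "adj (c *\<^sub>C x) = cnj c *\<^sub>C adj x"
    and adj_mult: "adj (x * y) = adj y * adj x"
    and cstar_identity: "norm (adj x * x) = (norm x)\<^sup>2"

definition csubspace :: "'a::unital_cstar_algebra set \<Rightarrow> bool" where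
  "csubspace S \<longleftrightarrow> 0 \<in> S \<and> (\<forall>x\<in>S. \<forall>y\<in>S. x + y \<in> S) \<and> (\<forall>c. \<forall>x\<in>S. c *\<^sub>C x \<in> S)"

text \<open>The unit of a subalgebra, if it has one, need not be that of the ambient algebra.\<close>

definition cstar_subalgebra :: "'a::unital_cstar_algebra set \<Rightarrow> bool" where
  "cstar_subalgebra B \<longleftrightarrow> csubspace B \<and> closed B \<and>
     (\<forall>x\<in>B. \<forall>y\<in>B. x * y \<in> B) \<and> (\<forall>x\<in>B. adj x \<in> B)"

definition is_unit_of :: "'a::unital_cstar_algebra \<Rightarrow> 'a set \<Rightarrow> bool" where
  "is_unit_of p B \<longleftrightarrow> p \<in> B \<and> (\<forall>x\<in>B. p * x = x \<and> x * p = x)"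

definition closed_ideal :: "'a::unital_cstar_algebra set \<Rightarrow> bool" where
  "closed_ideal J \<longleftrightarrow> csubspace J \<and> closed J \<and> (\<forall>x\<in>J. \<forall>a. a * x \<in> J \<and> x * a \<in> J)"

definition closed_ideal_generated :: "'a::unital_cstar_algebra \<Rightarrow> 'a set" where
  "closed_ideal_generated a = \<Inter>{J. closed_ideal J \<and> a \<in> J}"

definition full_element :: "'a::unital_cstar_algebra \<Rightarrow> bool" where
  "full_element a \<longleftrightarrow> closed_ideal_generated a = UNIV"

definition simple_cstar_algebra :: "'a::unital_cstar_algebra itself \<Rightarrow> bool" where
  "simple_cstar_algebra _ \<longleftrightarrow> (\<forall>J::'a set. closed_ideal J \<longrightarrow> J = {0} \<or> J = UNIV)"

definition invertible_element :: "'a::unital_cstar_algebra \<Rightarrow> bool" where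
  "invertible_element x \<longleftrightarrow> (\<exists>y. x * y = 1 \<and> y * x = 1)"

definition stable_rank_one :: "'a::unital_cstar_algebra itself \<Rightarrow> bool" where
  "stable_rank_one _ \<longleftrightarrow> closure {x::'a. invertible_element x} = UNIV"

definition spectrum_of :: "'a::unital_cstar_algebra \<Rightarrow> complex set" where
  "spectrum_of a = {z. \<not> invertible_element (a - z *\<^sub>C 1)}"

definition positive_element :: "'a::unital_cstar_algebra \<Rightarrow> bool" where
  "positive_element a \<longleftrightarrow> adj a = a \<and> spectrum_of a \<subseteq> complex_of_real ` {0..}"


section \<open>Comparison of projections\<close>

definition projection :: "'a::unital_cstar_algebra \<Rightarrow> bool" where
  "projection p \<longleftrightarrow> adj p = p \<and> p * p = p"

definition mvn_equiv :: "'a::unital_cstar_algebra \<Rightarrow> 'a \<Rightarrow> bool" where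
  "mvn_equiv p q \<longleftrightarrow> (\<exists>v. adj v * v = p \<and> v * adj v = q)"

definition mvn_le :: "'a::unital_cstar_algebra \<Rightarrow> 'a \<Rightarrow> bool" where
  "mvn_le p q \<longleftrightarrow> (\<exists>q'. projection q' \<and> q' \<in> range (\<lambda>x. q * x * q) \<and> mvn_equiv p q')"

text \<open>Comparison of a projection with a positive element, through its hereditary subalgebra.\<close>

definition mvn_le_pos :: "'a::unital_cstar_algebra \<Rightarrow> 'a \<Rightarrow> bool" where
  "mvn_le_pos p a \<longleftrightarrow>
     (\<exists>q. projection q \<and> q \<in> closure (range (\<lambda>x. a * x * a)) \<and> mvn_le p q)"

text \<open>
  The Murray-von Neumann semigroup consists of the classes of projections in all matrix algebras
  over the given algebra: square matrices \<open>P\<close>, \<open>Q\<close> of possibly different sizes are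
  equivalent via a rectangular matrix \<open>V\<close>, and addition of classes is given by block
  diagonal sums. So \<open>n[q]\<close> is the class of the \<open>n \<times> n\<close> diagonal matrix with all
  diagonal entries \<open>q\<close>.
\<close>

definition mat_adj :: "'a::unital_cstar_algebra mat \<Rightarrow> 'a mat" where
  "mat_adj V = map_mat adj (transpose_mat V)"

definition mat_projection :: "'a::unital_cstar_algebra mat \<Rightarrow> bool" where
  "mat_projection P \<longleftrightarrow> square_mat P \<and> mat_adj P = P \<and> P * P = P"

definition mat_mvn_equiv :: "'a::unital_cstar_algebra mat \<Rightarrow> 'a mat \<Rightarrow> bool" where
  "mat_mvn_equiv P Q \<longleftrightarrow>
     (\<exists>V \<in> carrier_mat (dim_row Q) (dim_row P). mat_adj V * V = P \<and> V * mat_adj V = Q)"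

definition mat_mvn_le :: "'a::unital_cstar_algebra mat \<Rightarrow> 'a mat \<Rightarrow> bool" where
  "mat_mvn_le P Q \<longleftrightarrow>
     (\<exists>E. mat_projection E \<and> E \<in> (\<lambda>X. Q * X * Q) ` carrier_mat (dim_row Q) (dim_row Q) \<and>
          mat_mvn_equiv P E)"

definition const_diag_mat :: "nat \<Rightarrow> 'a::unital_cstar_algebra \<Rightarrow> 'a mat" where
  "const_diag_mat n q = mat n n (\<lambda>(i, j). if i = j then q else 0)"

definition mult_class_le :: "nat \<Rightarrow> 'a::unital_cstar_algebra \<Rightarrow> 'a \<Rightarrow> bool" where
  "mult_class_le n q p \<longleftrightarrow> mat_mvn_le (const_diag_mat n q) (const_diag_mat 1 p)"


section \<open>The class of finite direct sums of matrix and interval algebras\<close>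

text \<open>
  \<open>f\<close> is a *-isomorphism from the C*-subalgebra \<open>B\<close> onto the *-algebra with carrier
  \<open>C\<close> and the given operations. No norm is needed on the target, since a *-isomorphism
  of C*-algebras is isometric.
\<close>

definition star_isomorphism ::
    "('a::unital_cstar_algebra \<Rightarrow> 'b) \<Rightarrow> 'a set \<Rightarrow> 'b set \<Rightarrow> ('b \<Rightarrow> 'b \<Rightarrow> 'b) \<Rightarrow> ('b \<Rightarrow> 'b \<Rightarrow> 'b) \<Rightarrow>
     (complex \<Rightarrow> 'b \<Rightarrow> 'b) \<Rightarrow> ('b \<Rightarrow> 'b) \<Rightarrow> bool" where
  "star_isomorphism f B C plus' times' scale' adj' \<longleftrightarrow> bij_betw f B C \<and>
     (\<forall>x\<in>B. \<forall>y\<in>B. f (x + y) = plus' (f x) (f y)) \<and>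
     (\<forall>x\<in>B. \<forall>y\<in>B. f (x * y) = times' (f x) (f y)) \<and>
     (\<forall>c. \<forall>x\<in>B. f (c *\<^sub>C x) = scale' c (f x)) \<and>
     (\<forall>x\<in>B. f (adj x) = adj' (f x))"

definition cmat_adj :: "complex mat \<Rightarrow> complex mat" where
  "cmat_adj M = map_mat cnj (transpose_mat M)"

definition iso_matrix_algebra :: "'a::unital_cstar_algebra set \<Rightarrow> nat \<Rightarrow> bool" where
  "iso_matrix_algebra B k \<longleftrightarrow>
     (\<exists>f. star_isomorphism f B (carrier_mat k k) (+) (*) (\<lambda>c M. c \<cdot>\<^sub>m M) cmat_adj)"

text \<open>
  Matrices over the continuous functions on the unit interval, as matrix-valued functions with
  continuous entries. Functions on the interval are represented by their extension by 0 to
  the real line, which is compatible with all pointwise operations.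
\<close>

definition interval_matrices :: "nat \<Rightarrow> (real \<Rightarrow> complex mat) set" where
  "interval_matrices k =
     {F. (\<forall>t. F t \<in> carrier_mat k k) \<and>
         (\<forall>i<k. \<forall>j<k. continuous_on {0..1} (\<lambda>t. F t $$ (i, j))) \<and>
         (\<forall>t. t \<notin> {0..1} \<longrightarrow> F t = 0\<^sub>m k k)}"

definition iso_interval_matrix_algebra :: "'a::unital_cstar_algebra set \<Rightarrow> nat \<Rightarrow> bool" where
  "iso_interval_matrix_algebra B k \<longleftrightarrow>
     (\<exists>f. star_isomorphism f B (interval_matrices k)
            (\<lambda>F G t. F t + G t) (\<lambda>F G t. F t * G t) (\<lambda>c F t. c \<cdot>\<^sub>m F t) (\<lambda>F t. cmat_adj (F t)))"

text \<open>
  \<open>I\<close> is the (internal) direct sum of the summands \<open>B i\<close>. Annihilation of distinct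
  summands implies uniqueness of the decomposition: if \<open>\<Sum>i<n. b i = 0\<close>, then
  \<open>adj (b i) * b i = 0\<close> for each \<open>i\<close>.
\<close>

definition cstar_direct_sum ::
    "'a::unital_cstar_algebra set \<Rightarrow> nat \<Rightarrow> (nat \<Rightarrow> 'a set) \<Rightarrow> bool" where
  "cstar_direct_sum I n B \<longleftrightarrow> (\<forall>i<n. cstar_subalgebra (B i)) \<and>
     (\<forall>i<n. \<forall>j<n. i \<noteq> j \<longrightarrow> (\<forall>x\<in>B i. \<forall>y\<in>B j. x * y = 0)) \<and>
     I = {\<Sum>i<n. b i | b. \<forall>i<n. b i \<in> B i}"

definition matrix_interval_class :: "'a::unital_cstar_algebra set \<Rightarrow> bool" where
  "matrix_interval_class I \<longleftrightarrow> cstar_subalgebra I \<and>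
     (\<exists>n\<ge>1. \<exists>B. cstar_direct_sum I n B \<and>
        (\<forall>i<n. \<exists>k\<ge>1. iso_matrix_algebra (B i) k \<or> iso_interval_matrix_algebra (B i) k))"


section \<open>Tracially AI algebras\<close>

definition tracially_AI :: "'a::unital_cstar_algebra itself \<Rightarrow> bool" where
  "tracially_AI _ \<longleftrightarrow>
     (\<forall>(F::'a set) b \<epsilon> n a. finite F \<and> b \<in> F \<and> b \<noteq> 0 \<and> \<epsilon> > (0::real) \<and> n > (0::nat) \<and>
          positive_element a \<and> full_element a \<longrightarrow>
        (\<exists>p I. projection p \<and> p \<noteq> 0 \<and> cstar_subalgebra I \<and> matrix_interval_class I \<and> is_unit_of p I \<and>
           (\<forall>x\<in>F. norm (x * p - p * x) < \<epsilon>) \<and>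
           (\<forall>x\<in>F. \<exists>y\<in>I. norm (p * x * p - y) < \<epsilon>) \<and>
           norm (p * b * p) \<ge> norm b - \<epsilon> \<and>
           mult_class_le n (1 - p) p \<and>
           mvn_le_pos (1 - p) a))"

end

theory Submission
  imports Defs "Jordan_Normal_Form.Char_Poly"
begin

text \<open>
  Suppose that \<open>A\<close> is simple and tracially AI and that some \<open>y\<close> is not a limit of invertible
  elements. The algebras of the class \<open>\<I>\<close> have dense invertible elements
  (\<open>matrix_interval_class_invertibles_dense\<close>): for \<open>M\<^sub>k(C([0,1]))\<close> one approximates by a
  polynomial path of matrices and pushes the parameter slightly off the real line, away from the
  zeros of the determinant. It follows that \<open>A\<close> is finite, that is, one-sided inverses are two-sided
  (\<open>tracially_AI_finite\<close>), so \<open>y\<close> has neither a left nor a right inverse. It also follows that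
  every nonzero hereditary subalgebra contains a nonzero projection, because an approximation with
  \<open>p = 1\<close> would make \<open>y\<close> a limit of invertible elements
  (\<open>nonzero_projection_in_hereditary_subalgebra\<close>).

  As \<open>y\<close> is not left invertible, there are nonzero projections on which \<open>y\<close> is arbitrarily small
  (\<open>small_on_hereditary_subalgebra\<close>), and likewise for its adjoint. Cutting them off replaces \<open>y\<close> by
  a nearby \<open>x\<close>, again no limit of invertible elements, that is a zero divisor on both sides; by
  simplicity there is one \<open>c \<noteq> 0\<close> with \<open>x c = c x = 0\<close>. It yields a projection \<open>r\<close> and an
  idempotent \<open>f = v v'\<close> equivalent to it with \<open>x r = 0\<close> and \<open>f x = 0\<close>.

  Now approximate \<open>X = x + v\<close> tracially, with \<open>q = 1 - p \<preceq> r\<close>. Up to a small error it is \<open>g (p + w)\<close> with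
  \<open>g\<close> invertible and \<open>w \<in> q A q\<close>. Only \<open>w\<close> obstructs invertibility, and it is repaired by room of the
  size of \<open>q\<close>: for a partial isometry \<open>t\<close> from \<open>q\<close> to a subprojection of \<open>r\<close>, the block matrix with rows
  \<open>w, \<delta> t*\<close> and \<open>\<delta> t, 0\<close> is invertible for every \<open>\<delta> > 0\<close>. The summand \<open>v\<close>, invertible from \<open>r\<close> to
  \<open>f\<close>, is eliminated by a Schur complement, which makes this room available inside \<open>A\<close>
  instead of in matrices over \<open>A\<close>. The result is an invertible element near \<open>x\<close>
  (\<open>annihilated_in_closure_of_invertibles\<close>), a contradiction.

  Functional calculus is replaced by two elementary tools: real and imaginary parts of a unitary
  have norm at most 1 (\<open>norm_le_one_of_squares_sum\<close>), and square roots are limits of an iteration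
  (\<open>sqrt_one_minus\<close>).
\<close>

section \<open>Invertibility and selfadjoint elements\<close>

lemma scaleC_zero_right [simp]: "c *\<^sub>C (0::'a::unital_cstar_algebra) = 0"
  using scaleC_add_right[of c "0::'a" 0] by simp

lemma scaleC_zero_left [simp]: "0 *\<^sub>C (x::'a::unital_cstar_algebra) = 0"
  using scaleC_add_left[of 0 0 x] by simp

lemma scaleC_one [simp]: "1 *\<^sub>C (x::'a::unital_cstar_algebra) = x"
  using scaleR_scaleC[of 1 x] by simp

lemma scaleC_minus_left [simp]: "(- c) *\<^sub>C (x::'a::unital_cstar_algebra) = - (c *\<^sub>C x)"
  using scaleC_add_left[of "- c" c x] by (simp add: eq_neg_iff_add_eq_0)

lemma scaleC_minus_right [simp]: "c *\<^sub>C (- x::'a::unital_cstar_algebra) = - (c *\<^sub>C x)"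
  using scaleC_add_right[of c "- x" x] by (simp add: eq_neg_iff_add_eq_0)

lemma scaleC_diff_right: "c *\<^sub>C (x - y::'a::unital_cstar_algebra) = c *\<^sub>C x - c *\<^sub>C y"
  using scaleC_add_right[of c x "- y"] by simp

lemmas scaleC_distribs = scaleC_add_right scaleC_diff_right scaleC_scaleC mult_scaleC_left mult_scaleC_right

lemma adj_zero [simp]: "adj (0::'a::unital_cstar_algebra) = 0"
  using adj_add[of "0::'a" 0] by simp

lemma adj_minus [simp]: "adj (- x::'a::unital_cstar_algebra) = - adj x"
  using adj_add[of "- x" x] by (simp add: eq_neg_iff_add_eq_0)

lemma adj_diff: "adj (x - y::'a::unital_cstar_algebra) = adj x - adj y"
  using adj_add[of x "- y"] by simp

lemma adj_one [simp]: "adj (1::'a::unital_cstar_algebra) = 1"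
  using adj_mult[of "adj 1::'a" 1] by (simp add: adj_adj)

lemma adj_scaleR [simp]: "adj (r *\<^sub>R (x::'a::unital_cstar_algebra)) = r *\<^sub>R adj x"
  by (simp add: scaleR_scaleC adj_scaleC)

lemma norm_adj [simp]: "norm (adj (x::'a::unital_cstar_algebra)) = norm x"
proof -
  have le: "norm y \<le> norm (adj y)" for y :: 'a
  proof (cases "y = 0")
    case False
    have "norm y * norm y \<le> norm (adj y) * norm y"
      using norm_mult_ineq[of "adj y" y] cstar_identity[of y] by (simp add: power2_eq_square)
    with False show ?thesis by simp
  qed simp
  from le[of x] le[of "adj x"] show ?thesis by (simp add: adj_adj)
qed

lemma norm_selfadjoint_square:
  "adj h = h \<Longrightarrow> norm (h * h) = (norm (h::'a::unital_cstar_algebra))\<^sup>2"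
  using cstar_identity[of h] by simp

lemma adj_mult_self_eq_zero: "adj x * x = 0 \<Longrightarrow> (x::'a::unital_cstar_algebra) = 0"
  using cstar_identity[of x] by simp

lemma norm_projection_le:
  assumes "projection (p::'a::unital_cstar_algebra)"
  shows "norm p \<le> 1"
proof -
  have "norm p * norm p = norm p"
    using assms cstar_identity[of p] by (simp add: projection_def power2_eq_square)
  thus ?thesis by auto
qed

lemma bounded_linear_adj: "bounded_linear (adj :: 'a::unital_cstar_algebra \<Rightarrow> 'a)"
  by (rule bounded_linear_intro[where K = 1]) (simp_all add: adj_add)

lemmas tendsto_adj [tendsto_intros] = bounded_linear.tendsto[OF bounded_linear_adj]

lemma invertible_one_minus:
  fixes x :: "'a::unital_cstar_algebra"
  assumes "norm x < 1"
  obtains y where "(1 - x) * y = 1" "y * (1 - x) = 1" "norm y \<le> 1 / (1 - norm x)"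
proof -
  define y where "y = (\<Sum>n. x ^ n)"
  have sg: "summable (\<lambda>n. norm x ^ n)" using assms by (simp add: summable_geometric)
  have sn: "summable (\<lambda>n. norm (x ^ n))"
    by (rule summable_comparison_test[OF _ sg]) (auto simp: norm_power_ineq)
  hence s: "summable (\<lambda>n. x ^ n)" by (rule summable_norm_cancel)
  have tail: "y = 1 + (\<Sum>n. x ^ Suc n)"
    unfolding y_def using suminf_split_head[OF s] by simp
  have l: "x * y = (\<Sum>n. x ^ Suc n)" unfolding y_def using suminf_mult[OF s, of x] by simp
  have r: "y * x = (\<Sum>n. x ^ Suc n)" unfolding y_def using suminf_mult2[OF s, of x]
    by (simp add: power_commutes)
  have "norm y \<le> (\<Sum>n. norm (x ^ n))" unfolding y_def by (rule summable_norm[OF sn])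
  also have "\<dots> \<le> (\<Sum>n. norm x ^ n)"
    by (rule suminf_le[OF _ sn sg]) (rule norm_power_ineq)
  also have "\<dots> = 1 / (1 - norm x)" using assms by (simp add: suminf_geometric)
  finally have n: "norm y \<le> 1 / (1 - norm x)" .
  have "y - x * y = 1" "y - y * x = 1" unfolding l r using tail by simp_all
  thus thesis by (intro that[OF _ _ n]) (simp_all add: left_diff_distrib right_diff_distrib)
qed

lemma invertible_element_near_one:
  fixes u :: "'a::unital_cstar_algebra"
  assumes "norm (1 - u) < 1"
  obtains w where "u * w = 1" "w * u = 1" "norm w \<le> 1 / (1 - norm (1 - u))"
  using invertible_one_minus[OF assms] by auto

lemma invertible_element_mult:
  fixes x y :: "'a::unital_cstar_algebra"
  assumes "invertible_element x" "invertible_element y"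
  shows "invertible_element (x * y)"
proof -
  obtain x' y' where "x * x' = 1" "x' * x = 1" "y * y' = 1" "y' * y = 1"
    using assms unfolding invertible_element_def by blast
  hence "(x * y) * (y' * x') = 1 \<and> (y' * x') * (x * y) = 1"
    by (metis mult.assoc mult_1_left)
  thus ?thesis unfolding invertible_element_def by blast
qed

lemma invertible_element_scaleC_one:
  "c \<noteq> 0 \<Longrightarrow> invertible_element (c *\<^sub>C (1::'a::unital_cstar_algebra))"
  unfolding invertible_element_def
  by (rule exI[where x = "inverse c *\<^sub>C 1"]) (simp add: mult_scaleC_left mult_scaleC_right scaleC_scaleC)

lemma invertible_element_scaleC:
  fixes x :: "'a::unital_cstar_algebra"
  assumes "c \<noteq> 0" "invertible_element x"
  shows "invertible_element (c *\<^sub>C x)"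
  using invertible_element_mult[OF invertible_element_scaleC_one[OF assms(1)] assms(2)]
  by (simp add: mult_scaleC_left)

lemma invertible_element_adj:
  fixes x :: "'a::unital_cstar_algebra"
  shows "invertible_element x \<Longrightarrow> invertible_element (adj x)"
  unfolding invertible_element_def by (metis adj_mult adj_one)

lemma commutes_with_inverse:
  fixes x :: "'a::monoid_mult"
  assumes "x * y = 1" "y * x = 1" "x * z = z * x"
  shows "y * z = z * y"
proof -
  have "y * z = y * (z * x) * y" using assms(1) by (simp add: mult.assoc)
  also have "\<dots> = y * x * z * y" by (simp only: assms(3)[symmetric] mult.assoc)
  finally show ?thesis by (simp add: assms(2))
qed

text \<open>
  A selfadjoint element has no purely imaginary spectrum: adding a large imaginary multiple of
  the unit turns \<open>h\<close> into an element whose norm grows slower than the distance that an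
  imaginary spectral value has moved.
\<close>

lemma selfadjoint_plus_imaginary_invertible:
  fixes h :: "'a::unital_cstar_algebra"
  assumes h: "adj h = h" and s: "s \<noteq> 0"
  shows "invertible_element (h + (\<i> * complex_of_real s) *\<^sub>C 1)"
proof -
  have pos: "invertible_element (h - (\<i> * complex_of_real s) *\<^sub>C 1)" if s: "s > 0" for s
  proof -
    define l where "l = (norm h)\<^sup>2 / s"
    have l0: "l \<ge> 0" using s unfolding l_def by simp
    define c where "c = h + (\<i> * complex_of_real l) *\<^sub>C 1"
    define z where "z = \<i> * complex_of_real (l + s)"
    have z0: "z \<noteq> 0" using s l0 unfolding z_def by (auto simp: complex_eq_iff)
    have "adj c * c = h * h + (l\<^sup>2) *\<^sub>R 1"
      unfolding c_def
      by (simp add: h adj_add adj_scaleC algebra_simps scaleC_distribs scaleR_scaleC power2_eq_square)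
    hence "(norm c)\<^sup>2 \<le> (norm h)\<^sup>2 + l\<^sup>2"
      using cstar_identity[of c] norm_triangle_ineq[of "h * h" "(l\<^sup>2) *\<^sub>R 1"]
        norm_selfadjoint_square[OF h] by simp
    also have "\<dots> < (l + s)\<^sup>2"
    proof -
      have "(norm h)\<^sup>2 = l * s" using s unfolding l_def by simp
      moreover have "0 \<le> l * s" "0 < s * s" using s l0 by auto
      ultimately show ?thesis by (simp add: power2_eq_square algebra_simps)
    qed
    finally have "norm c < l + s" using s l0 by (simp add: power_less_imp_less_base)
    moreover have "cmod z = l + s" using s l0 unfolding z_def by (simp add: norm_mult del: of_real_add)
    ultimately have "norm (inverse z *\<^sub>C c) < 1"
      using s l0 by (simp add: norm_scaleC norm_inverse inverse_eq_divide[of "l + s"] del: inverse_eq_divide)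
    then obtain y where "(1 - inverse z *\<^sub>C c) * y = 1" "y * (1 - inverse z *\<^sub>C c) = 1"
      using invertible_one_minus by blast
    hence "invertible_element (1 - inverse z *\<^sub>C c)"
      unfolding invertible_element_def by blast
    hence "invertible_element ((- z) *\<^sub>C (1 - inverse z *\<^sub>C c))"
      using z0 invertible_element_scaleC by (metis neg_equal_0_iff_equal)
    moreover have "(- z) *\<^sub>C (1 - inverse z *\<^sub>C c) = c - z *\<^sub>C 1"
      using z0 by (simp add: scaleC_diff_right scaleC_scaleC)
    moreover have "z = \<i> * complex_of_real l + \<i> * complex_of_real s"
      unfolding z_def by (simp add: distrib_left)
    hence "c - z *\<^sub>C 1 = h - (\<i> * complex_of_real s) *\<^sub>C 1"
      by (simp only: c_def scaleC_add_left) simp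
    ultimately show ?thesis by simp
  qed
  show ?thesis
  proof (cases "s > 0")
    case True
    from invertible_element_adj[OF pos[OF this]] show ?thesis
      by (simp add: h adj_diff adj_scaleC)
  next
    case False
    with s pos[of "- s"] show ?thesis by simp
  qed
qed

lemma selfadjoint_square_plus_invertible:
  fixes h :: "'a::unital_cstar_algebra"
  assumes h: "adj h = h" and s: "s > 0"
  shows "invertible_element (h * h + s *\<^sub>R 1)"
proof -
  define t where "t = sqrt s"
  have t: "t \<noteq> 0" "- t \<noteq> 0" "t * t = s" using s unfolding t_def by auto
  have "(h + (\<i> * complex_of_real t) *\<^sub>C 1) * (h + (\<i> * complex_of_real (- t)) *\<^sub>C 1) = h * h + s *\<^sub>R 1"
    by (simp add: algebra_simps scaleC_distribs scaleR_scaleC t(3)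
        flip: of_real_mult)
  thus ?thesis
    using invertible_element_mult[OF selfadjoint_plus_imaginary_invertible[OF h t(1)]
      selfadjoint_plus_imaginary_invertible[OF h t(2)]] by simp
qed

text \<open>
  The spectrum of \<open>h * h\<close> is seen by factoring \<open>h * h - z\<close> with a square root of \<open>z\<close>
  that is not real.
\<close>

lemma positive_element_square:
  fixes h :: "'a::unital_cstar_algebra"
  assumes h: "adj h = h"
  shows "positive_element (h * h)"
  unfolding positive_element_def
proof
  show "adj (h * h) = h * h" by (simp add: h adj_mult)
  show "spectrum_of (h * h) \<subseteq> complex_of_real ` {0..}"
  proof
    fix z assume z: "z \<in> spectrum_of (h * h)"
    define w where "w = csqrt z"
    have w: "w * w = z" unfolding w_def by (metis power2_csqrt power2_eq_square)
    have fac: "(h + (- w) *\<^sub>C 1) * (h + w *\<^sub>C 1) = h * h - z *\<^sub>C 1"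
      by (simp add: algebra_simps scaleC_distribs w)
    have inv: "invertible_element (h + v *\<^sub>C 1)" if "Im v \<noteq> 0" for v
    proof -
      define h' where "h' = h + (Re v) *\<^sub>R 1"
      have "adj h' = h'" unfolding h'_def by (simp add: adj_add h)
      from selfadjoint_plus_imaginary_invertible[OF this that]
      have "invertible_element (h + (complex_of_real (Re v) + \<i> * complex_of_real (Im v)) *\<^sub>C 1)"
        unfolding h'_def by (simp add: scaleR_scaleC add.assoc scaleC_add_left)
      thus ?thesis by (simp flip: complex_eq)
    qed
    have "Im w = 0"
    proof (rule ccontr)
      assume "Im w \<noteq> 0"
      hence "invertible_element (h * h - z *\<^sub>C 1)"
        using invertible_element_mult[OF inv[of "- w"] inv[of w]] fac by simp
      thus False using z unfolding spectrum_of_def by simp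
    qed
    hence "z = complex_of_real ((Re w)\<^sup>2)"
      by (metis w complex_is_Real_iff of_real_Re of_real_mult power2_eq_square)
    thus "z \<in> complex_of_real ` {0..}" by (rule image_eqI) simp
  qed
qed

section \<open>Square roots and absolute values\<close>

text \<open>
  The elements \<open>c\<close> and \<open>d\<close> are the real and imaginary part of \<open>u = c + \<i> d\<close>, which satisfies
  \<open>adj u * u = e\<close>. If \<open>e\<close> is the unit, then \<open>u\<close> is unitary; this bounds \<open>c\<close>
  without using that sums of positive elements are positive.
\<close>

lemma norm_le_one_of_squares_sum:
  fixes c d :: "'a::unital_cstar_algebra"
  assumes c: "adj c = c" and d: "adj d = d" and cd: "c * d = d * c"
    and e: "c * c + d * d = e" "norm e \<le> 1"
  shows "norm c \<le> 1"
proof -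
  define u where "u = c + \<i> *\<^sub>C d"
  have au: "adj u = c - \<i> *\<^sub>C d" unfolding u_def by (simp add: adj_add adj_scaleC c d)
  have "adj u * u = e"
    unfolding au unfolding u_def e(1)[symmetric]
    by (simp add: algebra_simps scaleC_distribs cd)
  hence "(norm u)\<^sup>2 \<le> 1" using cstar_identity[of u] e by simp
  hence u1: "norm u \<le> 1" by (simp add: power_le_one_iff abs_square_le_1)
  have "2 *\<^sub>R c = u + adj u" unfolding au unfolding u_def by (simp add: scaleR_2)
  hence "2 * norm c \<le> norm u + norm (adj u)"
    by (metis norm_scaleR norm_triangle_ineq abs_numeral)
  with u1 show ?thesis by simp
qed

text \<open>
  The square root of \<open>1 - b\<close> is \<open>1 - y\<close> for a fixed point \<open>y\<close> of \<open>y \<mapsto> (b + y\<^sup>2) / 2\<close>.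
  The same iteration for the real number 1 increases and stays below 1, and its increments
  dominate those of the iteration for \<open>b\<close>.
\<close>

fun sqrt_iterate :: "'a::real_algebra \<Rightarrow> nat \<Rightarrow> 'a" where
  "sqrt_iterate b 0 = 0"
| "sqrt_iterate b (Suc n) = (1/2) *\<^sub>R (b + sqrt_iterate b n * sqrt_iterate b n)"

lemma sqrt_iterate_commutes:
  fixes b :: "'a::real_algebra"
  shows "c * b = b * c \<Longrightarrow> c * sqrt_iterate b n = sqrt_iterate b n * c"
proof (induction n)
  case (Suc n)
  have "c * (sqrt_iterate b n * sqrt_iterate b n) = sqrt_iterate b n * sqrt_iterate b n * c"
    using Suc by (simp flip: mult.assoc) (simp add: mult.assoc)
  with Suc.prems show ?case by (simp add: distrib_left distrib_right)
qed simp

lemma sqrt_one_minus: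
  fixes b :: "'a::unital_cstar_algebra"
  assumes b: "adj b = b" "norm b \<le> 1"
  obtains y where "adj y = y" "norm y \<le> 1" "(1 - y) * (1 - y) = 1 - b"
    "\<And>c. c * b = b * c \<Longrightarrow> c * y = y * c"
proof -
  let ?Y = "sqrt_iterate b" and ?y = "sqrt_iterate (1::real)"
  have y0: "0 \<le> ?y n" "?y n \<le> 1" for n
  proof (induction n)
    case (Suc n)
    { case 1 show ?case by simp }
    { case 2 show ?case using mult_mono[OF Suc(2) Suc(2)] Suc by simp }
  qed simp_all
  have Yle: "norm (?Y n) \<le> ?y n" for n
  proof (induction n)
    case (Suc n)
    have "norm (?Y n * ?Y n) \<le> ?y n * ?y n"
      by (rule order_trans[OF norm_mult_ineq mult_mono[OF Suc Suc y0(1)]]) simp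
    thus ?case using norm_triangle_ineq[of b "?Y n * ?Y n"] b(2) by simp
  qed simp
  have step: "norm (?Y (Suc n) - ?Y n) \<le> ?y (Suc n) - ?y n" for n
  proof (induction n)
    case (Suc n)
    have cm: "?Y (Suc n) * ?Y n = ?Y n * ?Y (Suc n)"
      by (intro sqrt_iterate_commutes sqrt_iterate_commutes[symmetric]) simp
    have "?Y (Suc (Suc n)) - ?Y (Suc n)
        = (1/2) *\<^sub>R ((?Y (Suc n) + ?Y n) * (?Y (Suc n) - ?Y n))"
      using cm by (simp add: algebra_simps del: sqrt_iterate.simps(2)) (simp add: algebra_simps)
    hence "norm (?Y (Suc (Suc n)) - ?Y (Suc n))
        \<le> (1/2) * (norm (?Y (Suc n) + ?Y n) * norm (?Y (Suc n) - ?Y n))"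
      by (simp add: norm_mult_ineq del: sqrt_iterate.simps(2))
    also have "\<dots> \<le> (1/2) * ((?y (Suc n) + ?y n) * (?y (Suc n) - ?y n))"
      by (intro mult_left_mono mult_mono Suc order_trans[OF norm_triangle_ineq] add_mono Yle)
        (use y0 in \<open>auto intro: add_nonneg_nonneg simp del: sqrt_iterate.simps(2)\<close>)
    also have "\<dots> = ?y (Suc (Suc n)) - ?y (Suc n)"
    proof -
      have "?y n * ?y n = 2 * ?y (Suc n) - 1" by (simp add: add_divide_distrib)
      moreover have "?y (Suc (Suc n)) = (1 + ?y (Suc n) * ?y (Suc n)) / 2" by simp
      ultimately show ?thesis
        by (simp add: algebra_simps diff_divide_distrib add_divide_distrib del: sqrt_iterate.simps(2))
    qed
    finally show ?case .
  qed (use b in simp)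
  have "incseq ?y"
  proof (rule incseq_SucI)
    fix n
    have "0 \<le> ?y (Suc n) - ?y n" by (rule order_trans[OF norm_ge_zero step])
    thus "?y n \<le> ?y (Suc n)" by simp
  qed
  have "convergent ?y"
    using incseq_convergent[OF \<open>incseq ?y\<close>] y0(2) unfolding convergent_def by metis
  have "(\<lambda>n. ?y (Suc n) - ?y n) sums (lim ?y - ?y 0)"
    by (rule telescope_sums) (use \<open>convergent ?y\<close> convergent_LIMSEQ_iff in blast)
  hence "summable (\<lambda>n. ?Y (Suc n) - ?Y n)"
    by (intro summable_comparison_test[OF _ sums_summable]) (use step in auto)
  hence "convergent (\<lambda>n. \<Sum>k<n. ?Y (Suc k) - ?Y k)" by (simp add: summable_iff_convergent)
  hence "convergent ?Y" by (simp add: sum_lessThan_telescope del: sqrt_iterate.simps(2))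
  then obtain y where y: "?Y \<longlonglongrightarrow> y" unfolding convergent_def by blast
  have selfadj: "adj (?Y n) = ?Y n" for n
    by (induction n) (simp_all add: adj_add adj_mult b)
  show thesis
  proof (rule that)
    show "adj y = y"
      using LIMSEQ_unique[OF tendsto_adj[OF y]] y selfadj by simp
    show "norm y \<le> 1"
      by (rule LIMSEQ_le_const2[OF tendsto_norm[OF y]]) (use Yle y0 order_trans in blast)
    have "(\<lambda>n. ?Y (Suc n)) \<longlonglongrightarrow> (1/2) *\<^sub>R (b + y * y)"
      unfolding sqrt_iterate.simps by (intro tendsto_intros y)
    with LIMSEQ_Suc[OF y] have "y = (1/2) *\<^sub>R (b + y * y)" by (rule LIMSEQ_unique)
    hence "2 *\<^sub>R y = 2 *\<^sub>R ((1/2) *\<^sub>R (b + y * y))" by (rule arg_cong)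
    hence "2 *\<^sub>R y = b + y * y" by simp
    thus "(1 - y) * (1 - y) = 1 - b" by (simp add: algebra_simps scaleR_2)
    show "c * y = y * c" if "c * b = b * c" for c
    proof (rule LIMSEQ_unique)
      show "(\<lambda>n. c * ?Y n) \<longlonglongrightarrow> c * y" by (intro tendsto_intros y)
      show "(\<lambda>n. c * ?Y n) \<longlonglongrightarrow> y * c"
        unfolding sqrt_iterate_commutes[OF that] by (intro tendsto_intros y)
    qed
  qed
qed

text \<open>
  The element \<open>m * m\<close> is the absolute value of \<open>k\<close>, the square root of \<open>k\<^sup>2 = 1 - (1 - k\<^sup>2)\<close>.
  This square root exists because \<open>1 - k\<^sup>2\<close> has norm at most 1: its own square root is the
  imaginary part of a unitary with real part \<open>k\<close>. Square roots have the form \<open>1 - y\<close> with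
  \<open>norm y \<le> 1\<close>, so they have square roots \<open>m\<close> again; this expresses that they are positive.
\<close>

lemma absolute_value_exists:
  fixes k :: "'a::unital_cstar_algebra"
  assumes k: "adj k = k" "norm k \<le> 1"
  obtains m where "adj m = m" "(m * m) * (m * m) = k * k" "norm (1 - m * m) \<le> 1"
    "\<And>c. c * k = k * c \<Longrightarrow> c * (m * m) = m * m * c"
proof -
  have kk: "adj (k * k) = k * k" by (simp add: adj_mult k)
  have kk1: "norm (k * k) \<le> 1"
    using norm_selfadjoint_square[OF k(1)] k(2) by (simp add: power_le_one)
  obtain l where l: "adj l = l" "norm l \<le> 1" "(1 - l) * (1 - l) = 1 - k * k"
    "\<And>c. c * (k * k) = k * k * c \<Longrightarrow> c * l = l * c"
    using sqrt_one_minus[OF kk kk1] by blast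
  have cl: "k * l = l * k" by (rule l(4)) (simp add: mult.assoc)
  have "norm (1 - l) \<le> 1"
  proof (rule norm_le_one_of_squares_sum[of _ k 1])
    show "(1 - l) * k = k * (1 - l)" using cl by (simp add: algebra_simps)
  qed (simp_all add: l(1,3) k adj_diff)
  moreover have "adj (1 - l) = 1 - l" by (simp add: adj_diff l)
  ultimately have "norm (1 - k * k) \<le> 1"
    using norm_selfadjoint_square[of "1 - l"] l(3) by (simp add: power_le_one)
  moreover have "adj (1 - k * k) = 1 - k * k" by (simp add: adj_diff kk)
  ultimately obtain y where y: "adj y = y" "norm y \<le> 1" "(1 - y) * (1 - y) = 1 - (1 - k * k)"
    "\<And>c. c * (1 - k * k) = (1 - k * k) * c \<Longrightarrow> c * y = y * c"
    using sqrt_one_minus[of "1 - k * k"] by blast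
  obtain w where w: "adj w = w" "norm w \<le> 1" "(1 - w) * (1 - w) = 1 - y"
    using sqrt_one_minus[OF y(1,2)] by blast
  show thesis
  proof (rule that[of "1 - w"])
    show "adj (1 - w) = 1 - w" by (simp add: adj_diff w(1))
    show "(1 - w) * (1 - w) * ((1 - w) * (1 - w)) = k * k" using w(3) y(3) by simp
    show "norm (1 - (1 - w) * (1 - w)) \<le> 1" using w(3) y(2) by simp
    show "c * ((1 - w) * (1 - w)) = (1 - w) * (1 - w) * c" if "c * k = k * c" for c
    proof -
      have "c * (k * k) = k * k * c" using that by (metis mult.assoc)
      hence "c * y = y * c" by (intro y(4)) (simp add: algebra_simps)
      thus ?thesis unfolding w(3) by (simp add: algebra_simps)
    qed
  qed
qed

section \<open>Projections on which an element is small\<close>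

text \<open>
  Since \<open>x\<close> is not left invertible, \<open>h = adj x * x\<close> has 0 in its spectrum. The bump
  \<open>s\<^sup>2 / (h\<^sup>2 + s\<^sup>2)\<close> is concentrated where \<open>\<bar>h\<bar>\<close> is at most of order \<open>s\<close>, and
  \<open>a\<close> is the positive part of \<open>k = 2 s\<^sup>2 / (h\<^sup>2 + s\<^sup>2) - 1\<close>. It does not vanish, as \<open>h\<close> is not
  invertible, and any projection in the hereditary subalgebra generated by \<open>a\<close> lives
  where \<open>h\<close> is small. The elements \<open>k\<close> and \<open>d = 2 s h / (h\<^sup>2 + s\<^sup>2)\<close> are up to sign the real and
  imaginary part of the Cayley transform of \<open>h / s\<close>, whence their norms are at most 1.
\<close>

lemma small_on_hereditary_subalgebra:
  fixes x :: "'a::unital_cstar_algebra"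
  assumes x: "\<nexists>y. y * x = 1" and e: "e > 0"
  obtains a where "adj a = a" "a \<noteq> 0"
    "\<And>r. projection r \<Longrightarrow> r \<in> closure (range (\<lambda>y. (a * a) * y * (a * a))) \<Longrightarrow> norm (x * r) \<le> e"
proof -
  define s where "s = e\<^sup>2 / 2"
  have s: "s > 0" using e unfolding s_def by simp
  define h where "h = adj x * x"
  have h: "adj h = h" unfolding h_def by (simp add: adj_mult adj_adj)
  have "s\<^sup>2 > 0" using s by simp
  then obtain R where R: "(h * h + (s\<^sup>2) *\<^sub>R 1) * R = 1" "R * (h * h + (s\<^sup>2) *\<^sub>R 1) = 1"
    using selfadjoint_square_plus_invertible[OF h] unfolding invertible_element_def by blast
  have Rh: "R * h = h * R"
    by (rule commutes_with_inverse[OF R]) (simp add: algebra_simps)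
  have adjR: "adj R = R"
  proof -
    have "adj R * (h * h + (s\<^sup>2) *\<^sub>R 1) = 1"
      using arg_cong[OF R(1), of adj] by (simp add: adj_mult adj_add h)
    hence "adj R * ((h * h + (s\<^sup>2) *\<^sub>R 1) * R) = R" by (simp flip: mult.assoc)
    thus ?thesis unfolding R by simp
  qed
  have hhR: "h * (h * R) = 1 - (s\<^sup>2) *\<^sub>R R"
    using R(1) by (simp add: distrib_right mult.assoc eq_diff_eq)
  define k where "k = (2 * s\<^sup>2) *\<^sub>R R - 1"
  define d where "d = (2 * s) *\<^sub>R (h * R)"
  have k: "adj k = k" unfolding k_def by (simp add: adj_diff adjR)
  have d: "adj d = d" unfolding d_def by (simp add: adj_mult adjR h Rh)
  have hk: "h * k = k * h" unfolding k_def by (simp add: algebra_simps Rh)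
  have kR: "k * R = R * k" unfolding k_def by (simp add: algebra_simps)
  have kd: "k * d = d * k"
    unfolding d_def by (simp add: mult.assoc kR[symmetric]) (simp add: hk flip: mult.assoc)
  have "d * d = (4 * s\<^sup>2) *\<^sub>R (h * (h * R) * R)"
    unfolding d_def by (simp add: mult.assoc power2_eq_square) (simp add: Rh flip: mult.assoc)
  also have "\<dots> = (4 * s\<^sup>2) *\<^sub>R (R - (s\<^sup>2) *\<^sub>R (R * R))" unfolding hhR by (simp add: left_diff_distrib)
  finally have kkdd: "k * k + d * d = 1"
    unfolding k_def by (simp add: algebra_simps power2_eq_square flip: scaleR_2)
  have k1: "norm k \<le> 1" by (rule norm_le_one_of_squares_sum[OF k d kd kkdd]) simp
  have d1: "norm d \<le> 1"
    by (rule norm_le_one_of_squares_sum[OF d k kd[symmetric], of 1]) (use kkdd in \<open>simp_all add: add.commute\<close>)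
  obtain m where m: "adj m = m" "(m * m) * (m * m) = k * k" "norm (1 - m * m) \<le> 1"
    "\<And>c. c * k = k * c \<Longrightarrow> c * (m * m) = m * m * c"
    using absolute_value_exists[OF k k1] by blast
  define b where "b = m * m"
  have bb: "b * b = k * k" and b1: "norm (1 - b) \<le> 1" and kb: "k * b = b * k" and hb: "h * b = b * h"
    unfolding b_def by (rule m(2), rule m(3), rule m(4)[OF refl], rule m(4)[OF hk])
  define a where "a = (1/2) *\<^sub>R (b + k)"
  have a: "adj a = a" unfolding a_def b_def by (simp add: adj_add adj_mult m k)
  have ka: "k * a = a * a" unfolding a_def by (simp add: algebra_simps bb kb flip: scaleR_2)
  have ha: "h * a = a * h" unfolding a_def by (simp add: algebra_simps hk hb)
  show thesis
  proof (rule that[OF a])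
    show "a \<noteq> 0"
    proof
      assume "a = 0"
      hence "k = - (m * m)" unfolding a_def b_def by (simp add: eq_neg_iff_add_eq_0 add.commute)
      hence "(2 * s\<^sup>2) *\<^sub>R R = 1 - m * m" unfolding k_def by (simp add: algebra_simps)
      hence "2 *\<^sub>R ((s\<^sup>2) *\<^sub>R R) = 1 - m * m" by simp
      hence mm: "2 *\<^sub>R (h * (h * R)) = m * m + 1 *\<^sub>R 1"
        unfolding hhR scaleR_diff_right by (simp add: scaleR_2)
      obtain w where "w * (m * m + 1 *\<^sub>R 1) = 1"
        using selfadjoint_square_plus_invertible[OF m(1), of 1] unfolding invertible_element_def by auto
      hence "w * (2 *\<^sub>R (h * (h * R))) = 1" unfolding mm .
      moreover have "h * (h * R) = R * h * adj x * x"
        by (simp add: Rh[symmetric]) (simp add: Rh mult.assoc flip: h_def)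
      ultimately have "(w * (2 *\<^sub>R (R * h * adj x))) * x = 1" by (simp add: mult.assoc)
      with x show False by blast
    qed
    fix r :: 'a
    assume r: "projection r" "r \<in> closure (range (\<lambda>y. (a * a) * y * (a * a)))"
    have "closure (range (\<lambda>y. (a * a) * y * (a * a))) \<subseteq> {y. k * y = a * y}"
    proof (rule closure_minimal)
      show "closed {y. k * y = a * y}" by (intro closed_Collect_eq continuous_intros)
    qed (auto simp: ka mult.assoc[symmetric])
    with r have kr: "k * r = a * r" by blast
    define N where "N = norm (h * r)"
    have "(1 + a) * (h * r) = h * (r + a * r)" by (simp add: algebra_simps ha flip: mult.assoc)
    also have "\<dots> = h * ((1 + k) * r)" by (simp add: algebra_simps kr)
    also have "\<dots> = s *\<^sub>R (d * r)" unfolding k_def d_def by (simp add: mult.assoc power2_eq_square)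
    finally have "norm ((1 + a) * (h * r)) = s * norm (d * r)" using s by simp
    also have "\<dots> \<le> s * (1 * 1)"
      using s d1 norm_projection_le[OF r(1)]
      by (intro mult_left_mono order_trans[OF norm_mult_ineq] mult_mono) auto
    finally have 1: "norm ((1 + a) * (h * r)) \<le> s" by simp
    have "(1/2) *\<^sub>R 1 - a = (1/2) *\<^sub>R ((1 - b) - k)" unfolding a_def by (simp add: algebra_simps)
    hence "norm ((1/2) *\<^sub>R 1 - a) \<le> 1"
      using norm_triangle_ineq4[of "1 - b" k] b1 k1 by simp
    hence 2: "norm (((1/2) *\<^sub>R 1 - a) * (h * r)) \<le> N"
      using norm_mult_ineq[of "(1/2) *\<^sub>R 1 - a" "h * r"] mult_right_mono[of "norm ((1/2) *\<^sub>R 1 - a)" 1 N]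
      unfolding N_def by simp
    (* Comparing 1 + a with the scalar 3/2, from which it differs by at most 1, bounds h * r
       without an inverse of 1 + a. *)
    have split: "(3/2) *\<^sub>R (h * r) = (1 + a) * (h * r) + ((1/2) *\<^sub>R 1 - a) * (h * r)"
      using scaleR_add_left[of 1 "1/2" "h * r"] by (simp add: distrib_right left_diff_distrib)
    have "norm ((3/2) *\<^sub>R (h * r)) \<le> s + N"
      unfolding split by (rule order_trans[OF norm_triangle_ineq add_mono[OF 1 2]])
    hence "(3/2) * N \<le> s + N" unfolding N_def by simp
    hence N: "N \<le> e\<^sup>2" unfolding s_def by simp
    have "adj (x * r) * (x * r) = r * (h * r)"
      using r(1) unfolding h_def projection_def by (simp add: adj_mult mult.assoc)
    hence "(norm (x * r))\<^sup>2 \<le> norm r * norm (h * r)"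
      using cstar_identity[of "x * r"] norm_mult_ineq[of r "h * r"] by simp
    also have "\<dots> \<le> 1 * e\<^sup>2"
      by (rule mult_mono[OF norm_projection_le[OF r(1)] N[unfolded N_def]]) simp_all
    finally have "(norm (x * r))\<^sup>2 \<le> e\<^sup>2" by simp
    thus "norm (x * r) \<le> e" by (rule power2_le_imp_le) (use e in simp)
  qed
qed

section \<open>Simplicity\<close>

lemma simple_full_element:
  assumes "simple_cstar_algebra TYPE('a::unital_cstar_algebra)" "(a::'a) \<noteq> 0"
  shows "full_element a"
  using assms unfolding full_element_def closed_ideal_generated_def simple_cstar_algebra_def by blast

text \<open>The elements \<open>y\<close> with \<open>a * z * y = 0\<close> for all \<open>z\<close> form a proper closed ideal.\<close>

lemma simple_prime:
  assumes simple: "simple_cstar_algebra TYPE('a::unital_cstar_algebra)"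
    and "(a::'a) \<noteq> 0" "b \<noteq> 0"
  shows "\<exists>z. a * z * b \<noteq> 0"
proof -
  define J where "J = {y. \<forall>z. a * z * y = 0}"
  have "closed_ideal J"
    unfolding closed_ideal_def csubspace_def
  proof (intro conjI ballI allI)
    show "closed J" unfolding J_def by (intro closed_Collect_all closed_Collect_eq continuous_intros)
    fix y c assume y: "y \<in> J"
    show "c * y \<in> J" using y unfolding J_def by (auto simp flip: mult.assoc) (metis mult.assoc)
    show "y * c \<in> J" using y unfolding J_def by (auto simp flip: mult.assoc)
  qed (auto simp: J_def distrib_left mult_scaleC_right)
  moreover have "1 \<notin> J" unfolding J_def using \<open>a \<noteq> 0\<close> by (auto intro!: exI[of _ 1])
  ultimately have "J = {0}" using simple unfolding simple_cstar_algebra_def by blast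
  with \<open>b \<noteq> 0\<close> have "b \<notin> J" by simp
  thus ?thesis unfolding J_def by simp
qed

section \<open>Schur complements\<close>

text \<open>
  Read \<open>a11, a12, a21, a22\<close> as a block matrix, with an idempotent corner \<open>r\<close> added to the columns
  and \<open>f\<close> to the rows, and \<open>b11, b12, b21, b22\<close> as a right inverse of it. The element \<open>d\<close> is a
  left inverse of the \<open>f\<close>-\<open>r\<close>-corner of \<open>a11\<close>. Eliminating this corner leaves
  a block matrix from \<open>(1 - r) \<oplus> r\<close> to \<open>(1 - f) \<oplus> f\<close>, that is, an element of the ring itself,
  and the matching compression of the right inverse is a right inverse of it.
\<close>

lemma schur_complement_right_inverse:
  fixes r f d a11 :: "'a::ring_1"
  assumes r: "a12 * r = a12" "a22 * r = a22" "r * b21 = b21" "r * b22 = b22"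
    and d: "d * a11 * r = r" "d * f = d"
    and inv: "a11 * b11 + a12 * b21 = 1" "a11 * b12 + a12 * b22 = 0"
      "a21 * b11 + a22 * b21 = 0" "a21 * b12 + a22 * b22 = f"
  shows "((1 - a11 * d) * a11 + (1 - a11 * d) * a12 + a21 * (1 - d * a11) + (a22 - a21 * d * a12))
    * ((1 - r) * b11 * (1 - f) + (1 - r) * b12 + b21 * (1 - f) + b22) = 1"
proof -
  define U where "U = (1 - a11 * d) * a11 + a21 * (1 - d * a11)"
  define V where "V = (1 - a11 * d) * a12 + a22 - a21 * d * a12"
  define X where "X = b11 * (1 - f) + b12"
  define Y where "Y = b21 * (1 - f) + b22"
  have Ur: "U * r = 0"
    unfolding U_def using d(1) by (simp add: algebra_simps)
  have Vr: "V * r = V" unfolding V_def by (simp add: algebra_simps r)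
  have rY: "r * Y = Y" unfolding Y_def by (simp add: distrib_left r flip: mult.assoc)
  have UY: "U * Y = 0" by (metis Ur rY mult.assoc mult_zero_left)
  have "a11 * X + a12 * Y = (a11 * b11 + a12 * b21) * (1 - f) + (a11 * b12 + a12 * b22)"
    unfolding X_def Y_def by (simp add: algebra_simps)
  hence 1: "a11 * X + a12 * Y = 1 - f" unfolding inv by simp
  have "a21 * X + a22 * Y = (a21 * b11 + a22 * b21) * (1 - f) + (a21 * b12 + a22 * b22)"
    unfolding X_def Y_def by (simp add: algebra_simps)
  hence 2: "a21 * X + a22 * Y = f" unfolding inv by simp
  have "U * X + V * Y = (1 - a11 * d) * (a11 * X + a12 * Y) + (a21 * X + a22 * Y)
      - a21 * d * (a11 * X + a12 * Y)"
    unfolding U_def V_def by (simp add: algebra_simps)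
  also have "\<dots> = 1" unfolding 1 2 by (simp add: algebra_simps d)
  finally have UV: "U * X + V * Y = 1" .
  have "(U + V) * ((1 - r) * X + Y) = U * X - U * r * X + U * Y + (V * X - V * r * X) + V * Y"
    by (simp add: algebra_simps)
  also have "\<dots> = 1" unfolding Ur Vr UY using UV by simp
  finally show ?thesis
    unfolding U_def V_def X_def Y_def by (simp add: algebra_simps)
qed

text \<open>
  The element \<open>p + w\<close> fails to be invertible only in the corner of \<open>q = 1 - p\<close>, and \<open>t\<close> embeds \<open>q\<close> into
  \<open>r\<close>. Hence for \<open>\<delta> > 0\<close> the block matrix
  with first row \<open>p + w, \<delta> t'\<close> and second row \<open>\<delta> t, \<delta> (r - t t')\<close> is invertible on
  \<open>1 \<oplus> r\<close>, because \<open>w\<close> sits in a block of the form \<open>w, \<delta>; \<delta>, 0\<close>. Multiplication by \<open>g\<close> and \<open>v\<close> turns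
  the first entry into \<open>z\<close> and the second summand into \<open>f = v v'\<close>. Since \<open>j v'\<close> inverts the
  \<open>f\<close>-\<open>r\<close>-corner of \<open>z\<close>, the Schur complement is an invertible element of the algebra, and
  it tends to \<open>z - z j v' z\<close> for \<open>\<delta> \<rightarrow> 0\<close>. The factors \<open>g\<close> and \<open>g'\<close> stay fixed in this limit,
  however large they are. In a finite algebra right inverses suffice.
\<close>

lemma schur_complement_in_closure_of_invertibles:
  fixes z r v v' j g g' p w t t' :: "'a::unital_cstar_algebra"
  assumes finite: "\<And>x y::'a. x * y = 1 \<Longrightarrow> y * x = 1"
    and z: "z = g * (p + w)" and g: "g * g' = 1"
    and p: "p * p = p" "w * p = 0" "p * w = 0"
    and t: "t' * t = 1 - p" "t * p = 0" "p * t' = 0" "r * t = t" "t' * r = t'"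
    and r: "r * r = r" "v' * v = r" "v * r = v" "r * v' = v'"
    and j: "r * j = j" "j * r = j" "j * (v' * z * r) = r"
  shows "z - z * (j * v') * z \<in> closure {x. invertible_element x}"
proof -
  define d where "d = j * v'"
  (* c is the part of r not reached by t. *)
  define c where "c = r - t * t'"
  have c: "c * c = c" "c * t = 0" "t' * c = 0" "c * r = c" "r * c = c"
  proof -
    have "t * t' * t = t" by (simp add: mult.assoc t(1)) (simp add: right_diff_distrib t)
    moreover have "t' * (t * t') = t'" by (simp add: t(1) flip: mult.assoc) (simp add: left_diff_distrib t)
    ultimately show ct: "c * t = 0" and "t' * c = 0" and "c * r = c" "r * c = c"
      unfolding c_def using t r(1)
      by (simp_all add: left_diff_distrib right_diff_distrib mult.assoc) (simp flip: mult.assoc)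
    thus "c * c = c" by (subst (2) c_def) (simp add: right_diff_distrib flip: mult.assoc)
  qed
  define T where "T \<delta> = (1 - z * d) * z + (1 - z * d) * (\<delta> *\<^sub>R (g * t'))
    + \<delta> *\<^sub>R (v * t) * (1 - d * z) + (\<delta> *\<^sub>R (v * c) - \<delta> *\<^sub>R (v * t) * d * (\<delta> *\<^sub>R (g * t')))" for \<delta> :: real
  have T: "invertible_element (T \<delta>)" if \<delta>: "\<delta> > 0" for \<delta>
  proof -
    define K where "K = (1 / \<delta>) *\<^sub>R c - (1 / \<delta>\<^sup>2) *\<^sub>R (t * w * t')"
    have "T \<delta> * ((1 - r) * (p * g') * (1 - v * v') + (1 - r) * ((1 / \<delta>) *\<^sub>R (t' * v'))
        + (1 / \<delta>) *\<^sub>R (t * g') * (1 - v * v') + K * v') = 1"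
      unfolding T_def
    proof (rule schur_complement_right_inverse)
      show "d * z * r = r" unfolding d_def using j by (simp add: mult.assoc)
      show "d * (v * v') = d"
        unfolding d_def using r by (simp add: mult.assoc) (simp flip: mult.assoc add: r)
      have "z * p = g * p" unfolding z by (simp add: mult.assoc distrib_right p)
      hence "z * (p * g') + g * (t' * t) * g' = g * g'"
        unfolding t(1) by (simp add: algebra_simps flip: mult.assoc)
      thus "z * (p * g') + \<delta> *\<^sub>R (g * t') * ((1 / \<delta>) *\<^sub>R (t * g')) = 1"
        using \<delta> g by (simp add: mult.assoc)
      have zt: "z * t' = g * (w * t')" unfolding z by (simp add: mult.assoc distrib_right t)
      have "t' * (t * (w * t')) = w * t'"
        by (simp add: t(1) flip: mult.assoc) (simp add: left_diff_distrib p)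
      hence "\<delta> *\<^sub>R (t' * K) = - ((1 / \<delta>) *\<^sub>R (w * t'))"
        unfolding K_def using \<delta> c by (simp add: right_diff_distrib mult.assoc power2_eq_square)
      hence "\<delta> *\<^sub>R (g * t') * (K * v') = g * (- ((1 / \<delta>) *\<^sub>R (w * t'))) * v'"
        by (metis mult.assoc mult_scaleR_left mult_scaleR_right)
      moreover have "z * ((1 / \<delta>) *\<^sub>R (t' * v')) = g * ((1 / \<delta>) *\<^sub>R (w * t')) * v'"
        using zt by (simp flip: mult.assoc)
      ultimately show "z * ((1 / \<delta>) *\<^sub>R (t' * v')) + \<delta> *\<^sub>R (g * t') * (K * v') = 0" by simp
      show "\<delta> *\<^sub>R (v * t) * (p * g') + \<delta> *\<^sub>R (v * c) * ((1 / \<delta>) *\<^sub>R (t * g')) = 0"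
        using t c by (simp add: mult.assoc) (simp flip: mult.assoc add: t c)
      have "c * K = (1 / \<delta>) *\<^sub>R c"
        unfolding K_def by (simp add: right_diff_distrib c flip: mult.assoc)
      hence "\<delta> *\<^sub>R (v * c) * (K * v') = v * c * v'"
        using \<delta> by (simp add: mult.assoc) (simp flip: mult.assoc)
      moreover have "\<delta> *\<^sub>R (v * t) * ((1 / \<delta>) *\<^sub>R (t' * v')) = v * (t * t') * v'"
        using \<delta> by (simp add: mult.assoc)
      ultimately show "\<delta> *\<^sub>R (v * t) * ((1 / \<delta>) *\<^sub>R (t' * v')) + \<delta> *\<^sub>R (v * c) * (K * v') = v * v'"
        unfolding c_def using r by (simp add: algebra_simps flip: mult.assoc)
      show "r * (K * v') = K * v'"
        unfolding K_def by (simp add: algebra_simps flip: mult.assoc add: c t)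
      show "r * ((1 / \<delta>) *\<^sub>R (t * g')) = (1 / \<delta>) *\<^sub>R (t * g')"
        by (simp add: t flip: mult.assoc)
    qed (simp_all add: mult.assoc t c)
    with finite show ?thesis unfolding invertible_element_def by blast
  qed
  have "(\<lambda>n. T (1 / real (Suc n))) \<longlonglongrightarrow> T 0"
    unfolding T_def by (intro tendsto_intros LIMSEQ_Suc lim_1_over_n)
  moreover have "T (1 / real (Suc n)) \<in> closure {x. invertible_element x}" for n
    using T[of "1 / real (Suc n)"] closure_subset by fastforce
  ultimately have "T 0 \<in> closure {x. invertible_element x}"
    by (meson closed_closure closed_sequentially)
  moreover have "T 0 = z - z * d * z" unfolding T_def by (simp add: left_diff_distrib)
  ultimately show ?thesis unfolding d_def by simp
qed

section \<open>Matrices over the continuous functions on the interval\<close>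

text \<open>The determinant vanishes only if \<open>- c\<close> is one of the finitely many eigenvalues.\<close>

lemma small_shift_det_nonzero:
  fixes A :: "complex mat"
  assumes A: "A \<in> carrier_mat k k" and e: "e > 0"
  obtains c where "cmod c < e" "Determinant.det (A + c \<cdot>\<^sub>m 1\<^sub>m k) \<noteq> 0"
proof -
  let ?S = "{c. Determinant.det (A + c \<cdot>\<^sub>m 1\<^sub>m k) = 0}"
  have "Determinant.det (A + c \<cdot>\<^sub>m 1\<^sub>m k) = 0 \<longleftrightarrow> poly (char_poly A) (- c) = 0" for c
    using A eigenvalue_root_char_poly[OF A, of "- c"] eigenvalue_det[OF A, of "- c"]
    unfolding char_matrix_def by auto
  hence "?S = uminus -` {z. poly (char_poly A) z = 0}" by auto
  moreover have "char_poly A \<noteq> 0" using degree_monic_char_poly[OF A] by auto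
  ultimately have "finite ?S"
    by (simp only:) (rule finite_vimageI[OF poly_roots_finite], simp_all)
  then obtain d where d: "d > 0" "\<And>c. c \<in> ?S \<Longrightarrow> c \<noteq> 0 \<Longrightarrow> d \<le> dist 0 c"
    using finite_set_avoid[of ?S 0] by blast
  define c where "c = complex_of_real (min d e / 2)"
  have c: "cmod c = min d e / 2" "c \<noteq> 0" using d(1) e unfolding c_def by (auto simp: norm_of_real)
  show thesis
  proof (rule that)
    show "cmod c < e" using c d(1) e by auto
    show "Determinant.det (A + c \<cdot>\<^sub>m 1\<^sub>m k) \<noteq> 0"
      using d(2)[of c] c d(1) e by (auto simp: dist_norm)
  qed
qed

lemma nonzero_det_inverse:
  fixes A :: "complex mat"
  assumes A: "A \<in> carrier_mat k k" "Determinant.det A \<noteq> 0"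
  obtains G where "G \<in> carrier_mat k k" "A * G = 1\<^sub>m k" "G * A = 1\<^sub>m k"
proof
  let ?c = "1 / Determinant.det A"
  show "?c \<cdot>\<^sub>m adj_mat A \<in> carrier_mat k k" using adj_mat(1)[OF A(1)] by simp
  have "?c \<cdot>\<^sub>m (Determinant.det A \<cdot>\<^sub>m 1\<^sub>m k) = 1\<^sub>m k" using A(2) by (intro eq_matI) auto
  thus "A * (?c \<cdot>\<^sub>m adj_mat A) = 1\<^sub>m k" "(?c \<cdot>\<^sub>m adj_mat A) * A = 1\<^sub>m k"
    using adj_mat[OF A(1)] mult_smult_distrib[OF A(1) adj_mat(1)[OF A(1)]]
      mult_smult_assoc_mat[OF adj_mat(1)[OF A(1)] A(1)] by simp_all
qed

definition on_interval :: "nat \<Rightarrow> (real \<Rightarrow> complex mat) \<Rightarrow> real \<Rightarrow> complex mat" where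
  "on_interval k M t = (if t \<in> {0..1} then M t else 0\<^sub>m k k)"

lemma on_interval_in:
  assumes "\<And>t. M t \<in> carrier_mat k k"
    and "\<And>i j. i < k \<Longrightarrow> j < k \<Longrightarrow> continuous_on {0..1} (\<lambda>t. M t $$ (i, j))"
  shows "on_interval k M \<in> interval_matrices k"
  unfolding interval_matrices_def
proof (intro CollectI conjI allI impI)
  fix i j assume "i < k" "j < k"
  show "continuous_on {0..1} (\<lambda>t. on_interval k M t $$ (i, j))"
    by (rule continuous_on_eq[OF assms(2)[OF \<open>i < k\<close> \<open>j < k\<close>]]) (simp add: on_interval_def)
qed (use assms(1) in \<open>auto simp: on_interval_def\<close>)

text \<open>
  Complex coefficients allow the approximating polynomial to be evaluated off the real line.
\<close>

lemma complex_weierstrass_interval: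
  fixes f :: "real \<Rightarrow> complex"
  assumes f: "continuous_on {0..1} f" and e: "e > 0"
  obtains P where "\<And>t. t \<in> {0..1} \<Longrightarrow> cmod (f t - poly P (of_real t)) < e"
proof -
  have real: "\<exists>P. \<forall>t\<in>{0..1}. cmod (complex_of_real (h t) - poly P (of_real t)) < e / 2"
    if h: "continuous_on {0..1} h" for h :: "real \<Rightarrow> real"
  proof -
    obtain g where g: "real_polynomial_function g" "\<And>t. t \<in> {0..1} \<Longrightarrow> \<bar>h t - g t\<bar> < e / 2"
      using Stone_Weierstrass_real_polynomial_function[OF compact_Icc h, of "e / 2"] e by auto
    obtain a n where a: "g = (\<lambda>x. \<Sum>i\<le>n. a i * x ^ i)"
      using g(1) real_polynomial_function_iff_sum by blast
    define P where "P = (\<Sum>i\<le>n. monom (complex_of_real (a i)) i)"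
    have "poly P (of_real t) = complex_of_real (g t)" for t
      unfolding P_def a by (simp add: poly_sum poly_monom)
    thus ?thesis using g(2) by (intro exI[of _ P]) (simp flip: of_real_diff)
  qed
  obtain P where P: "\<forall>t\<in>{0..1}. cmod (complex_of_real (Re (f t)) - poly P (of_real t)) < e / 2"
    using real[of "\<lambda>t. Re (f t)"] f by (auto intro: continuous_intros)
  obtain Q where Q: "\<forall>t\<in>{0..1}. cmod (complex_of_real (Im (f t)) - poly Q (of_real t)) < e / 2"
    using real[of "\<lambda>t. Im (f t)"] f by (auto intro: continuous_intros)
  show thesis
  proof (rule that[of "P + Polynomial.smult \<i> Q"])
    fix t :: real assume t: "t \<in> {0..1}"
    have "f t - poly (P + Polynomial.smult \<i> Q) (of_real t)
        = (of_real (Re (f t)) - poly P (of_real t)) + \<i> * (of_real (Im (f t)) - poly Q (of_real t))"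
      by (subst complex_eq) (simp add: algebra_simps)
    also have "cmod \<dots> \<le> cmod (of_real (Re (f t)) - poly P (of_real t))
        + cmod (of_real (Im (f t)) - poly Q (of_real t))"
      by (rule order_trans[OF norm_triangle_ineq]) (simp add: norm_mult)
    also have "\<dots> < e" using bspec[OF P t] bspec[OF Q t] by linarith
    finally show "cmod (f t - poly (P + Polynomial.smult \<i> Q) (of_real t)) < e" .
  qed
qed

lemma poly_imaginary_shift:
  assumes e: "e > 0"
  shows "\<forall>\<^sub>F \<eta> in at_right 0. \<forall>t\<in>{0..1}. cmod (poly q (of_real t) - poly q (of_real t + \<i> * of_real \<eta>)) < e"
proof -
  have "uniformly_continuous_on (cball 0 2) (poly q)"
    by (intro compact_uniformly_continuous compact_cball continuous_intros)
  then obtain d where d: "d > 0"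
    "\<And>z w. z \<in> cball 0 2 \<Longrightarrow> w \<in> cball 0 2 \<Longrightarrow> dist w z < d \<Longrightarrow> dist (poly q w) (poly q z) < e"
    using e unfolding uniformly_continuous_on_def by blast
  have "cmod (poly q (of_real t) - poly q (of_real t + \<i> * of_real \<eta>)) < e"
    if \<eta>: "\<eta> \<in> {0<..<min d 1}" and t: "t \<in> {0..1}" for \<eta> t :: real
  proof -
    have "cmod (of_real t + \<i> * of_real \<eta>) \<le> \<bar>t\<bar> + \<bar>\<eta>\<bar>"
      by (rule order_trans[OF norm_triangle_ineq]) (simp add: norm_mult)
    hence c: "of_real t + \<i> * of_real \<eta> \<in> cball (0::complex) 2" "complex_of_real t \<in> cball 0 2"
      using \<eta> t by auto
    have "dist (complex_of_real t) (of_real t + \<i> * of_real \<eta>) < d"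
      using \<eta> by (simp add: dist_norm norm_mult)
    from d(2)[OF c this] show ?thesis by (simp add: dist_norm)
  qed
  moreover have "\<forall>\<^sub>F \<eta> in at_right 0. \<eta> \<in> {0<..<min d 1}"
    by (rule eventually_at_right_real) (use d(1) in simp)
  ultimately show ?thesis by (auto elim: eventually_mono)
qed

text \<open>
  In general no constant scalar shift makes a continuous path of matrices invertible, since the
  eigenvalues along the path may fill a neighbourhood of 0. But the path
  is approximated by a polynomial path \<open>N\<close>, and after a small scalar
  shift \<open>det N\<close> is not the zero polynomial. It then has finitely many complex zeros, so
  that the parallel path \<open>t \<mapsto> N (t + \<i> \<eta>)\<close> avoids them for all small \<open>\<eta>\<close> but finitely many.
\<close>

lemma interval_matrices_approx_invertible:
  assumes F: "F \<in> interval_matrices k" and e: "e > 0"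
  shows "\<exists>S\<in>interval_matrices k. \<exists>G\<in>interval_matrices k.
    (\<lambda>t. S t * G t) = on_interval k (\<lambda>t. 1\<^sub>m k) \<and> (\<lambda>t. G t * S t) = on_interval k (\<lambda>t. 1\<^sub>m k) \<and>
    (\<forall>t\<in>{0..1}. \<forall>i<k. \<forall>j<k. cmod (F t $$ (i, j) - S t $$ (i, j)) < e)"
proof -
  have ev: "comm_ring_hom (\<lambda>p. poly p a)" "semiring_hom (\<lambda>p. poly p a)" for a :: complex
    by (unfold_locales; simp)+
  have "\<exists>P. \<forall>t\<in>{0..1}. cmod (F t $$ (i, j) - poly P (of_real t)) < e / 3" if "i < k" "j < k" for i j
  proof -
    have "continuous_on {0..1} (\<lambda>t. F t $$ (i, j))"
      using F that unfolding interval_matrices_def by blast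
    moreover have "e / 3 > 0" using e by simp
    ultimately show ?thesis using complex_weierstrass_interval by metis
  qed
  then obtain P where P: "\<And>i j t. i < k \<Longrightarrow> j < k \<Longrightarrow> t \<in> {0..1} \<Longrightarrow>
      cmod (F t $$ (i, j) - poly (P i j) (of_real t)) < e / 3" by metis
  define M where "M = Matrix.mat k k (\<lambda>(i, j). P i j)"
  have M: "map_mat (\<lambda>p. poly p 0) M \<in> carrier_mat k k" unfolding M_def by simp
  obtain c where c: "cmod c < e / 3" "Determinant.det (map_mat (\<lambda>p. poly p 0) M + c \<cdot>\<^sub>m 1\<^sub>m k) \<noteq> 0"
    using small_shift_det_nonzero[OF M, of "e / 3"] e by auto
  define N where "N = M + [:c:] \<cdot>\<^sub>m 1\<^sub>m k"
  have N: "N \<in> carrier_mat k k" unfolding N_def M_def by simp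
  define D where "D = Determinant.det N"
  have "map_mat (\<lambda>p. poly p 0) N = map_mat (\<lambda>p. poly p 0) M + c \<cdot>\<^sub>m 1\<^sub>m k"
    unfolding N_def M_def by (intro eq_matI) auto
  hence "poly D 0 \<noteq> 0" using c(2) comm_ring_hom.hom_det[OF ev(1)[of 0], of N] unfolding D_def by simp
  hence "finite {z. poly D z = 0}" by (intro poly_roots_finite) auto
  moreover have "\<forall>\<^sub>F \<eta> in at_right 0. Im z \<noteq> \<eta>" for z
  proof (cases "Im z > 0")
    case True
    from eventually_at_right_real[OF this] show ?thesis by (rule eventually_mono) auto
  next
    case False
    show ?thesis by (rule eventually_mono[OF eventually_at_right_less[of 0]]) (use False in auto)
  qed
  ultimately have ev1: "\<forall>\<^sub>F \<eta> in at_right 0. \<forall>z\<in>{z. poly D z = 0}. Im z \<noteq> \<eta>"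
    by (intro eventually_ball_finite) blast+
  have ev2: "\<forall>\<^sub>F \<eta> in at_right 0. \<forall>i\<in>{..<k}. \<forall>j\<in>{..<k}. \<forall>t\<in>{0..1}.
      cmod (poly (N $$ (i, j)) (of_real t) - poly (N $$ (i, j)) (of_real t + \<i> * of_real \<eta>)) < e / 3"
    by (intro eventually_ball_finite finite_lessThan ballI poly_imaginary_shift) (use e in simp)
  obtain \<eta> where \<eta>: "\<forall>z\<in>{z. poly D z = 0}. Im z \<noteq> \<eta>"
    "\<forall>i\<in>{..<k}. \<forall>j\<in>{..<k}. \<forall>t\<in>{0..1}.
      cmod (poly (N $$ (i, j)) (of_real t) - poly (N $$ (i, j)) (of_real t + \<i> * of_real \<eta>)) < e / 3"
    using eventually_happens'[OF _ eventually_conj[OF ev1 ev2]] by auto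
  define z where "z t = complex_of_real t + \<i> * of_real \<eta>" for t
  have Dz: "poly D (z t) \<noteq> 0" for t using \<eta>(1) unfolding z_def by auto
  have z: "continuous_on {0..1} z" unfolding z_def by (intro continuous_intros)
  define S where "S t = map_mat (\<lambda>p. poly p (z t)) N" for t
  define G where "G t = (1 / poly D (z t)) \<cdot>\<^sub>m map_mat (\<lambda>p. poly p (z t)) (adj_mat N)" for t
  note adjN = adj_mat[OF N, folded D_def]
  have carr: "S t \<in> carrier_mat k k" "G t \<in> carrier_mat k k" for t
    unfolding S_def G_def using N adjN(1) by auto
  have one: "(1 / poly D (z t)) \<cdot>\<^sub>m map_mat (\<lambda>p. poly p (z t)) (D \<cdot>\<^sub>m 1\<^sub>m k) = 1\<^sub>m k" for t
    using Dz[of t] by (intro eq_matI) auto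
  have SG: "S t * G t = 1\<^sub>m k" "G t * S t = 1\<^sub>m k" for t
  proof -
    have "S t * G t = (1 / poly D (z t)) \<cdot>\<^sub>m (map_mat (\<lambda>p. poly p (z t)) N * map_mat (\<lambda>p. poly p (z t)) (adj_mat N))"
      unfolding S_def G_def by (rule mult_smult_distrib) (use N adjN in auto)
    thus "S t * G t = 1\<^sub>m k"
      using one[of t] by (simp add: semiring_hom.mat_hom_mult[OF ev(2) N adjN(1), symmetric] adjN)
    have "G t * S t = (1 / poly D (z t)) \<cdot>\<^sub>m (map_mat (\<lambda>p. poly p (z t)) (adj_mat N) * map_mat (\<lambda>p. poly p (z t)) N)"
      unfolding S_def G_def by (rule mult_smult_assoc_mat) (use N adjN in auto)
    thus "G t * S t = 1\<^sub>m k"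
      using one[of t] by (simp add: semiring_hom.mat_hom_mult[OF ev(2) adjN(1) N, symmetric] adjN)
  qed
  show ?thesis
  proof (rule bexI[of _ "on_interval k S"], rule bexI[of _ "on_interval k G"], intro conjI ballI allI impI)
    show "on_interval k S \<in> interval_matrices k"
    proof (rule on_interval_in[OF carr(1)])
      fix i j assume "i < k" "j < k"
      hence "S t $$ (i, j) = poly (N $$ (i, j)) (z t)" for t unfolding S_def using N by auto
      thus "continuous_on {0..1} (\<lambda>t. S t $$ (i, j))" by (simp add: z continuous_on_poly)
    qed
    show "on_interval k G \<in> interval_matrices k"
    proof (rule on_interval_in[OF carr(2)])
      fix i j assume "i < k" "j < k"
      hence "G t $$ (i, j) = 1 / poly D (z t) * poly (adj_mat N $$ (i, j)) (z t)" for t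
        unfolding G_def using adjN(1) by auto
      thus "continuous_on {0..1} (\<lambda>t. G t $$ (i, j))"
        by (simp only:) (intro continuous_intros z continuous_on_poly, use Dz in auto)
    qed
    show "(\<lambda>t. on_interval k S t * on_interval k G t) = on_interval k (\<lambda>t. 1\<^sub>m k)"
      "(\<lambda>t. on_interval k G t * on_interval k S t) = on_interval k (\<lambda>t. 1\<^sub>m k)"
      by (auto simp: on_interval_def SG)
    fix t :: real and i j assume t: "t \<in> {0..1}" and ij: "i < k" "j < k"
    have "N $$ (i, j) = P i j + (if i = j then [:c:] else 0)" unfolding N_def M_def using ij by simp
    hence "cmod (poly (P i j) (of_real t) - poly (N $$ (i, j)) (of_real t)) < e / 3" using c(1) e by auto
    moreover have "cmod (F t $$ (i, j) - poly (P i j) (of_real t)) < e / 3" by (rule P[OF ij t])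
    moreover have "cmod (poly (N $$ (i, j)) (of_real t) - poly (N $$ (i, j)) (z t)) < e / 3"
      using \<eta>(2) ij t unfolding z_def by auto
    moreover have "on_interval k S t $$ (i, j) = poly (N $$ (i, j)) (z t)"
      unfolding S_def on_interval_def using N ij t by auto
    ultimately show "cmod (F t $$ (i, j) - on_interval k S t $$ (i, j)) < e"
      using norm_triangle_lt[of "F t $$ (i, j) - poly (P i j) (of_real t)"
          "poly (P i j) (of_real t) - poly (N $$ (i, j)) (z t)" e]
        norm_triangle_ineq[of "poly (P i j) (of_real t) - poly (N $$ (i, j)) (of_real t)"
          "poly (N $$ (i, j)) (of_real t) - poly (N $$ (i, j)) (z t)"]
      by simp
  qed
qed

section \<open>Density of the invertible elements in direct sums of matrix and interval algebras\<close>

definition invertibles_dense_in :: "'a::unital_cstar_algebra set \<Rightarrow> 'a \<Rightarrow> bool" where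
  "invertibles_dense_in B u \<longleftrightarrow>
     (\<forall>y\<in>B. \<forall>e>0. \<exists>s\<in>B. \<exists>s'\<in>B. s * s' = u \<and> s' * s = u \<and> norm (y - s) < e)"

text \<open>
  Since the subalgebra is closed under the operations, so is the target; the facts are stated for the
  inverse map because approximation takes place in the target.
\<close>

lemma star_isomorphism_inverse:
  fixes B :: "'a::unital_cstar_algebra set"
  assumes f: "star_isomorphism f B C plus' times' scale' adj'" and B: "cstar_subalgebra B"
  obtains g where "\<And>F. F \<in> C \<Longrightarrow> g F \<in> B" "\<And>F. F \<in> C \<Longrightarrow> f (g F) = F"
    "\<And>x. x \<in> B \<Longrightarrow> f x \<in> C" "\<And>x. x \<in> B \<Longrightarrow> g (f x) = x"
    "\<And>F G. F \<in> C \<Longrightarrow> G \<in> C \<Longrightarrow> plus' F G \<in> C \<and> g (plus' F G) = g F + g G"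
    "\<And>F G. F \<in> C \<Longrightarrow> G \<in> C \<Longrightarrow> times' F G \<in> C \<and> g (times' F G) = g F * g G"
    "\<And>c F. F \<in> C \<Longrightarrow> scale' c F \<in> C \<and> g (scale' c F) = c *\<^sub>C g F"
    "\<And>F. F \<in> C \<Longrightarrow> adj' F \<in> C \<and> g (adj' F) = adj (g F)"
proof -
  define g where "g = the_inv_into B f"
  have bij: "bij_betw f B C" using f unfolding star_isomorphism_def by blast
  hence inj: "inj_on f B" and img: "f ` B = C" unfolding bij_betw_def by auto
  have gB: "g F \<in> B" and fg: "f (g F) = F" if "F \<in> C" for F
    using that inj img unfolding g_def by (auto simp: the_inv_into_into f_the_inv_into_f)
  have gf: "g (f x) = x" if "x \<in> B" for x
    using that inj unfolding g_def by (rule the_inv_into_f_f[rotated])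
  have fC: "f x \<in> C" if "x \<in> B" for x using that img by blast
  have closed: "x + y \<in> B" "x * y \<in> B" "c *\<^sub>C x \<in> B" "adj x \<in> B" if "x \<in> B" "y \<in> B" for x y c
    using B that unfolding cstar_subalgebra_def csubspace_def by auto
  have hom: "f (x + y) = plus' (f x) (f y)" "f (x * y) = times' (f x) (f y)"
    "f (c *\<^sub>C x) = scale' c (f x)" "f (adj x) = adj' (f x)" if "x \<in> B" "y \<in> B" for x y c
    using f that unfolding star_isomorphism_def by auto
  show thesis
  proof (rule that[OF gB fg fC gf])
    fix F G c assume F: "F \<in> C" and G: "G \<in> C"
    note gBs = gB[OF F] gB[OF G]
    show "plus' F G \<in> C \<and> g (plus' F G) = g F + g G"
      using fC[OF closed(1)[OF gBs]] gf[OF closed(1)[OF gBs]] hom(1)[OF gBs] fg F G by simp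
    show "times' F G \<in> C \<and> g (times' F G) = g F * g G"
      using fC[OF closed(2)[OF gBs]] gf[OF closed(2)[OF gBs]] hom(2)[OF gBs] fg F G by simp
  next
    fix F c assume F: "F \<in> C"
    note gBs = gB[OF F] gB[OF F]
    show "scale' c F \<in> C \<and> g (scale' c F) = c *\<^sub>C g F"
      using fC[OF closed(3)[OF gBs]] gf[OF closed(3)[OF gBs]] hom(3)[OF gBs] fg F by simp
    show "adj' F \<in> C \<and> g (adj' F) = adj (g F)"
      using fC[OF closed(4)[OF gBs]] gf[OF closed(4)[OF gBs]] hom(4)[OF gBs] fg F by simp
  qed
qed

text \<open>A small scalar shift of a matrix is invertible, and its preimage is a small shift of the element.\<close>

lemma matrix_algebra_invertibles_dense:
  fixes B :: "'a::unital_cstar_algebra set"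
  assumes "iso_matrix_algebra B k" and B: "cstar_subalgebra B"
  shows "\<exists>u. is_unit_of u B \<and> invertibles_dense_in B u"
proof -
  obtain f where f: "star_isomorphism f B (carrier_mat k k) (+) (*) (\<lambda>c M. c \<cdot>\<^sub>m M) cmat_adj"
    using assms(1) unfolding iso_matrix_algebra_def by blast
  obtain g where g: "\<And>F. F \<in> carrier_mat k k \<Longrightarrow> g F \<in> B" "\<And>F. F \<in> carrier_mat k k \<Longrightarrow> f (g F) = F"
    "\<And>x. x \<in> B \<Longrightarrow> f x \<in> carrier_mat k k" "\<And>x. x \<in> B \<Longrightarrow> g (f x) = x"
    "\<And>F G. F \<in> carrier_mat k k \<Longrightarrow> G \<in> carrier_mat k k \<Longrightarrow> F + G \<in> carrier_mat k k \<and> g (F + G) = g F + g G"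
    "\<And>F G. F \<in> carrier_mat k k \<Longrightarrow> G \<in> carrier_mat k k \<Longrightarrow> F * G \<in> carrier_mat k k \<and> g (F * G) = g F * g G"
    "\<And>c F. F \<in> carrier_mat k k \<Longrightarrow> c \<cdot>\<^sub>m F \<in> carrier_mat k k \<and> g (c \<cdot>\<^sub>m F) = c *\<^sub>C g F"
    "\<And>F. F \<in> carrier_mat k k \<Longrightarrow> cmat_adj F \<in> carrier_mat k k \<and> g (cmat_adj F) = adj (g F)"
    using star_isomorphism_inverse[OF f B] by blast
  define u where "u = g (1\<^sub>m k)"
  have "is_unit_of u B"
    unfolding is_unit_of_def
  proof (intro conjI ballI)
    show "u \<in> B" unfolding u_def by (rule g(1)) simp
    fix x assume x: "x \<in> B"
    have "g (1\<^sub>m k) * g (f x) = g (1\<^sub>m k * f x)" "g (f x) * g (1\<^sub>m k) = g (f x * 1\<^sub>m k)"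
      using g(6)[OF one_carrier_mat g(3)[OF x]] g(6)[OF g(3)[OF x] one_carrier_mat] by simp_all
    thus "u * x = x" "x * u = x" unfolding u_def using g(3,4)[OF x] by simp_all
  qed
  moreover have "invertibles_dense_in B u"
    unfolding invertibles_dense_in_def
  proof (intro ballI allI impI)
    fix y and e :: real assume y: "y \<in> B" and e: "e > 0"
    have "e / (norm u + 1) > 0" using e by (simp add: add_nonneg_pos)
    then obtain c where c: "cmod c < e / (norm u + 1)" "Determinant.det (f y + c \<cdot>\<^sub>m 1\<^sub>m k) \<noteq> 0"
      using small_shift_det_nonzero[OF g(3)[OF y]] by metis
    let ?S = "f y + c \<cdot>\<^sub>m 1\<^sub>m k"
    have S: "?S \<in> carrier_mat k k" using g(3)[OF y] by simp
    obtain G where G: "G \<in> carrier_mat k k" "?S * G = 1\<^sub>m k" "G * ?S = 1\<^sub>m k"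
      using nonzero_det_inverse[OF S c(2)] by blast
    have gS: "g ?S = y + c *\<^sub>C u"
      using g(4)[OF y] g(5)[OF g(3)[OF y], of "c \<cdot>\<^sub>m 1\<^sub>m k"] g(7)[OF one_carrier_mat, of c] unfolding u_def by simp
    have "cmod c * (norm u + 1) < e" using c(1) by (simp add: pos_less_divide_eq add_nonneg_pos)
    moreover have "norm (y - g ?S) \<le> cmod c * (norm u + 1)" unfolding gS by (simp add: norm_scaleC distrib_left)
    ultimately have "norm (y - g ?S) < e" by linarith
    moreover have "g ?S * g G = u" "g G * g ?S = u"
      using g(6)[OF S G(1)] g(6)[OF G(1) S] unfolding u_def G by simp_all
    ultimately show "\<exists>s\<in>B. \<exists>s'\<in>B. s * s' = u \<and> s' * s = u \<and> norm (y - s) < e"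
      using g(1)[OF S] g(1)[OF G(1)] by blast
  qed
  ultimately show ?thesis by blast
qed

lemma smult_smult_mat: "a \<cdot>\<^sub>m (b \<cdot>\<^sub>m A) = (a * b :: 'a::semigroup_mult) \<cdot>\<^sub>m A"
  by (intro eq_matI) (auto simp: mult.assoc)

definition scalar_path :: "nat \<Rightarrow> (real \<Rightarrow> real) \<Rightarrow> real \<Rightarrow> complex mat" where
  "scalar_path k h = on_interval k (\<lambda>t. complex_of_real (h t) \<cdot>\<^sub>m 1\<^sub>m k)"

definition matrix_unit :: "nat \<Rightarrow> nat \<Rightarrow> nat \<Rightarrow> complex mat" where
  "matrix_unit k a b = Matrix.mat k k (\<lambda>(i, j). if i = a \<and> j = b then 1 else 0)"

text \<open>
  The norm of the target of an isomorphism is not given, so a bound by the entries comes from the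
  algebraic structure: a real function \<open>h\<close> with \<open>\<bar>h\<bar> \<le> 1\<close> is the real part of the unitary
  \<open>h + \<i> sqrt (1 - h\<^sup>2)\<close>, and a general path is a combination of the finitely many matrix
  units with scalar functions as coefficients.
\<close>

lemma interval_matrix_norm_bound:
  fixes g :: "(real \<Rightarrow> complex mat) \<Rightarrow> 'a::unital_cstar_algebra"
  assumes plus: "\<And>F G. F \<in> interval_matrices k \<Longrightarrow> G \<in> interval_matrices k \<Longrightarrow>
        g (\<lambda>t. F t + G t) = g F + g G"
    and times: "\<And>F G. F \<in> interval_matrices k \<Longrightarrow> G \<in> interval_matrices k \<Longrightarrow>
        g (\<lambda>t. F t * G t) = g F * g G"
    and scale: "\<And>c F. F \<in> interval_matrices k \<Longrightarrow> g (\<lambda>t. c \<cdot>\<^sub>m F t) = c *\<^sub>C g F"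
    and adj: "\<And>F. F \<in> interval_matrices k \<Longrightarrow> g (\<lambda>t. cmat_adj (F t)) = adj (g F)"
  shows "\<exists>K\<ge>0. \<forall>F\<in>interval_matrices k. \<forall>m\<ge>0.
    (\<forall>t\<in>{0..1}. \<forall>i<k. \<forall>j<k. cmod (F t $$ (i, j)) \<le> m) \<longrightarrow> norm (g F) \<le> m * K"
proof -
  define u where "u = g (on_interval k (\<lambda>t. 1\<^sub>m k))"
  have one_in: "on_interval k (\<lambda>t. 1\<^sub>m k) \<in> interval_matrices k"
    by (rule on_interval_in) (auto intro: continuous_intros)
  have "projection u"
    unfolding projection_def u_def
  proof
    have "(\<lambda>t. cmat_adj (on_interval k (\<lambda>t. 1\<^sub>m k) t)) = on_interval k (\<lambda>t. 1\<^sub>m k)"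
      by (auto simp: on_interval_def cmat_adj_def intro!: ext eq_matI)
    thus "adj (g (on_interval k (\<lambda>t. 1\<^sub>m k))) = g (on_interval k (\<lambda>t. 1\<^sub>m k))"
      using adj[OF one_in] by simp
    have "(\<lambda>t. on_interval k (\<lambda>t. 1\<^sub>m k) t * on_interval k (\<lambda>t. 1\<^sub>m k) t) = on_interval k (\<lambda>t. 1\<^sub>m k)"
      by (auto simp: on_interval_def)
    thus "g (on_interval k (\<lambda>t. 1\<^sub>m k)) * g (on_interval k (\<lambda>t. 1\<^sub>m k)) = g (on_interval k (\<lambda>t. 1\<^sub>m k))"
      using times[OF one_in one_in] by simp
  qed
  hence u1: "norm u \<le> 1" by (rule norm_projection_le)
  have sc_in: "scalar_path k h \<in> interval_matrices k" if "continuous_on {0..1} h" for h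
    unfolding scalar_path_def
  proof (rule on_interval_in)
    fix i j assume "i < k" "j < k"
    thus "continuous_on {0..1} (\<lambda>t. (complex_of_real (h t) \<cdot>\<^sub>m 1\<^sub>m k) $$ (i, j))"
      using that by (cases "i = j") (auto intro!: continuous_intros)
  qed simp
  have sc_adj: "adj (g (scalar_path k h)) = g (scalar_path k h)" if "continuous_on {0..1} h" for h
  proof -
    have "(\<lambda>t. cmat_adj (scalar_path k h t)) = scalar_path k h"
      by (auto simp: scalar_path_def on_interval_def cmat_adj_def intro!: ext eq_matI)
    thus ?thesis using adj[OF sc_in[OF that]] by simp
  qed
  have sc_mult: "(\<lambda>t. scalar_path k h t * scalar_path k h' t) = scalar_path k (\<lambda>t. h t * h' t)" for h h'
  proof
    fix t show "scalar_path k h t * scalar_path k h' t = scalar_path k (\<lambda>t. h t * h' t) t"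
      unfolding scalar_path_def on_interval_def
      by (auto simp: mult_smult_assoc_mat[OF one_carrier_mat smult_carrier_mat[OF one_carrier_mat]]
          smult_smult_mat)
  qed
  have unit_ball: "norm (g (scalar_path k h)) \<le> 1"
    if h: "continuous_on {0..1} h" "\<And>t. t \<in> {0..1} \<Longrightarrow> \<bar>h t\<bar> \<le> 1" for h
  proof -
    define h' where "h' t = sqrt (1 - (h t)\<^sup>2)" for t
    have h': "continuous_on {0..1} h'" unfolding h'_def by (intro continuous_intros h)
    show ?thesis
    proof (rule norm_le_one_of_squares_sum)
      show "g (scalar_path k h) * g (scalar_path k h') = g (scalar_path k h') * g (scalar_path k h)"
        using times[OF sc_in[OF h(1)] sc_in[OF h']] times[OF sc_in[OF h'] sc_in[OF h(1)]]
        unfolding sc_mult by (simp add: mult.commute)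
      have "(\<lambda>t. scalar_path k (\<lambda>t. h t * h t) t + scalar_path k (\<lambda>t. h' t * h' t) t)
          = on_interval k (\<lambda>t. 1\<^sub>m k)"
      proof
        fix t :: real
        have "h t * h t + h' t * h' t = 1" if "t \<in> {0..1}"
        proof -
          have "(h t)\<^sup>2 \<le> 1" using h(2)[OF that] by (simp add: abs_square_le_1)
          thus ?thesis unfolding h'_def by (simp flip: power2_eq_square)
        qed
        thus "scalar_path k (\<lambda>t. h t * h t) t + scalar_path k (\<lambda>t. h' t * h' t) t
            = on_interval k (\<lambda>t. 1\<^sub>m k) t"
          by (auto simp: scalar_path_def on_interval_def simp flip: of_real_mult of_real_add
              add_smult_distrib_right_mat[OF one_carrier_mat])
      qed
      thus "g (scalar_path k h) * g (scalar_path k h) + g (scalar_path k h') * g (scalar_path k h') = u"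
        using times[OF sc_in[OF h(1)] sc_in[OF h(1)]] times[OF sc_in[OF h'] sc_in[OF h']]
          plus[OF sc_in sc_in, of "\<lambda>t. h t * h t" "\<lambda>t. h' t * h' t"] h(1) h'
        unfolding sc_mult u_def by (simp add: continuous_on_mult)
    qed (use sc_adj h(1) h' u1 in auto)
  qed
  have scalar_bound: "norm (g (scalar_path k h)) \<le> m"
    if h: "continuous_on {0..1} h" "\<And>t. t \<in> {0..1} \<Longrightarrow> \<bar>h t\<bar> \<le> m" "m > 0" for h m
  proof -
    have c: "continuous_on {0..1} (\<lambda>t. h t / m)" using h by (intro continuous_intros) auto
    have "(\<lambda>t. complex_of_real m \<cdot>\<^sub>m scalar_path k (\<lambda>t. h t / m) t) = scalar_path k h"
      using h(3) by (auto simp: scalar_path_def on_interval_def smult_smult_mat)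
    hence "g (scalar_path k h) = complex_of_real m *\<^sub>C g (scalar_path k (\<lambda>t. h t / m))"
      using scale[OF sc_in[OF c], of "complex_of_real m"] by simp
    moreover have "norm (g (scalar_path k (\<lambda>t. h t / m))) \<le> 1"
      by (rule unit_ball[OF c]) (use h in auto)
    ultimately show ?thesis using h(3) by (simp add: norm_scaleC mult_left_le)
  qed
  define E where "E a b = on_interval k (\<lambda>t. matrix_unit k a b)" for a b
  have E_in: "E a b \<in> interval_matrices k" for a b
    unfolding E_def by (rule on_interval_in) (auto simp: matrix_unit_def)
  define entry where "entry h a b = on_interval k (\<lambda>t. h t \<cdot>\<^sub>m matrix_unit k a b)"
    for h :: "real \<Rightarrow> complex" and a b
  have entry_bound: "entry h a b \<in> interval_matrices k \<and> norm (g (entry h a b)) \<le> m * (2 * norm (g (E a b)))"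
    if h: "continuous_on {0..1} h" "\<And>t. t \<in> {0..1} \<Longrightarrow> cmod (h t) \<le> m" "m > 0" for h a b m
  proof
    show in': "entry h a b \<in> interval_matrices k"
      unfolding entry_def
      by (rule on_interval_in) (use h(1) in \<open>auto simp: matrix_unit_def intro!: continuous_intros\<close>)
    define p where "p = scalar_path k (\<lambda>t. Re (h t))"
    define q where "q = scalar_path k (\<lambda>t. Im (h t))"
    have cont: "continuous_on {0..1} (\<lambda>t. Re (h t))" "continuous_on {0..1} (\<lambda>t. Im (h t))"
      using h(1) by (auto intro: continuous_intros)
    have pq: "p \<in> interval_matrices k" "q \<in> interval_matrices k"
      unfolding p_def q_def using cont by (auto intro: sc_in)
    have "entry (\<lambda>t. complex_of_real (f t)) a b = (\<lambda>t. scalar_path k f t * E a b t)" for f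
    proof
      fix t
      have "(complex_of_real (f t) \<cdot>\<^sub>m 1\<^sub>m k) * matrix_unit k a b = complex_of_real (f t) \<cdot>\<^sub>m matrix_unit k a b"
        by (subst mult_smult_assoc_mat[of _ k k _ k]) (auto simp: matrix_unit_def)
      thus "entry (\<lambda>t. complex_of_real (f t)) a b t = scalar_path k f t * E a b t"
        by (auto simp: entry_def scalar_path_def E_def on_interval_def)
    qed
    note re = this
    have "entry h a b = (\<lambda>t. (p t * E a b t) + \<i> \<cdot>\<^sub>m (q t * E a b t))"
    proof
      fix t
      have "p t * E a b t = entry (\<lambda>t. complex_of_real (Re (h t))) a b t"
        "q t * E a b t = entry (\<lambda>t. complex_of_real (Im (h t))) a b t"
        unfolding p_def q_def by (simp_all add: re)
      thus "entry h a b t = (p t * E a b t) + \<i> \<cdot>\<^sub>m (q t * E a b t)"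
        by (auto simp: entry_def on_interval_def matrix_unit_def complex_eq[symmetric] intro!: eq_matI)
    qed
    moreover have prod_in: "(\<lambda>t. p t * E a b t) \<in> interval_matrices k" "(\<lambda>t. q t * E a b t) \<in> interval_matrices k"
    proof -
      have *: "entry (\<lambda>t. complex_of_real (f t)) a b \<in> interval_matrices k" if "continuous_on {0..1} f" for f
        unfolding entry_def
        by (rule on_interval_in) (use that in \<open>auto simp: matrix_unit_def intro!: continuous_intros\<close>)
      show "(\<lambda>t. p t * E a b t) \<in> interval_matrices k" "(\<lambda>t. q t * E a b t) \<in> interval_matrices k"
        unfolding p_def q_def re[symmetric] using * cont by auto
    qed
    moreover have "(\<lambda>t. \<i> \<cdot>\<^sub>m (q t * E a b t)) \<in> interval_matrices k"
    proof -
      have "(\<lambda>t. \<i> \<cdot>\<^sub>m (q t * E a b t)) = entry (\<lambda>t. \<i> * complex_of_real (Im (h t))) a b"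
      proof
        fix t
        have "q t * E a b t = entry (\<lambda>t. complex_of_real (Im (h t))) a b t"
          unfolding q_def by (simp add: re)
        thus "\<i> \<cdot>\<^sub>m (q t * E a b t) = entry (\<lambda>t. \<i> * complex_of_real (Im (h t))) a b t"
          by (auto simp: entry_def on_interval_def smult_smult_mat)
      qed
      moreover have "entry (\<lambda>t. \<i> * complex_of_real (Im (h t))) a b \<in> interval_matrices k"
        unfolding entry_def
        by (rule on_interval_in) (use cont in \<open>auto simp: matrix_unit_def intro!: continuous_intros\<close>)
      ultimately show ?thesis by simp
    qed
    ultimately have eq: "g (entry h a b) = g p * g (E a b) + \<i> *\<^sub>C (g q * g (E a b))"
      using plus scale times[OF pq(1) E_in] times[OF pq(2) E_in] by simp
    have "norm (g p) \<le> m" "norm (g q) \<le> m"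
      unfolding p_def q_def using cont h
      by (auto intro!: scalar_bound order_trans[OF abs_Re_le_cmod] order_trans[OF abs_Im_le_cmod])
    hence "norm (g p * g (E a b)) \<le> m * norm (g (E a b))" "norm (g q * g (E a b)) \<le> m * norm (g (E a b))"
      by (auto intro!: order_trans[OF norm_mult_ineq] mult_right_mono)
    thus "norm (g (entry h a b)) \<le> m * (2 * norm (g (E a b)))"
      unfolding eq using norm_triangle_ineq[of "g p * g (E a b)" "\<i> *\<^sub>C (g q * g (E a b))"]
      by (simp add: norm_scaleC)
  qed
  define K where "K = (\<Sum>(a, b)\<in>{..<k} \<times> {..<k}. 2 * norm (g (E a b)))"
  have zero: "g (on_interval k (\<lambda>t. 0\<^sub>m k k)) = 0"
  proof -
    have z: "on_interval k (\<lambda>t. 0\<^sub>m k k) \<in> interval_matrices k" by (rule on_interval_in) auto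
    have "(\<lambda>t. on_interval k (\<lambda>t. 0\<^sub>m k k) t + on_interval k (\<lambda>t. 0\<^sub>m k k) t) = on_interval k (\<lambda>t. 0\<^sub>m k k)"
      by (auto simp: on_interval_def)
    thus ?thesis using plus[OF z z] by simp
  qed
  (* Induction on a set S of positions outside of which the entries of F vanish. *)
  have main: "norm (g F) \<le> m * (\<Sum>(a, b)\<in>S. 2 * norm (g (E a b)))"
    if "finite S" "S \<subseteq> {..<k} \<times> {..<k}" "F \<in> interval_matrices k" "m > 0"
      "\<And>t i j. t \<in> {0..1} \<Longrightarrow> i < k \<Longrightarrow> j < k \<Longrightarrow> cmod (F t $$ (i, j)) \<le> m"
      "\<And>t i j. i < k \<Longrightarrow> j < k \<Longrightarrow> (i, j) \<notin> S \<Longrightarrow> F t $$ (i, j) = 0" for S F m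
    using that
  proof (induction S arbitrary: F rule: finite_induct)
    case empty
    have "F = on_interval k (\<lambda>t. 0\<^sub>m k k)"
    proof
      fix t
      have "F t \<in> carrier_mat k k" using empty.prems(2) unfolding interval_matrices_def by blast
      thus "F t = on_interval k (\<lambda>t. 0\<^sub>m k k) t"
        using empty.prems(5) by (auto simp: on_interval_def intro!: eq_matI)
    qed
    thus ?case using zero by simp
  next
    case (insert s S)
    obtain a b where s: "s = (a, b)" "a < k" "b < k" using insert.prems(1) by auto
    have Fc: "F t \<in> carrier_mat k k" and Fcont: "i < k \<Longrightarrow> j < k \<Longrightarrow> continuous_on {0..1} (\<lambda>t. F t $$ (i, j))"
      and Fout: "t \<notin> {0..1} \<Longrightarrow> F t = 0\<^sub>m k k" for t i j
      using insert.prems(2) unfolding interval_matrices_def by auto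
    define H where "H = on_interval k (\<lambda>t. Matrix.mat k k (\<lambda>(i, j). if (i, j) = s then 0 else F t $$ (i, j)))"
    define h where "h t = F t $$ (a, b)" for t
    have H: "H \<in> interval_matrices k"
      unfolding H_def
    proof (rule on_interval_in)
      fix i j assume "i < k" "j < k"
      thus "continuous_on {0..1} (\<lambda>t. Matrix.mat k k (\<lambda>(i, j). if (i, j) = s then 0 else F t $$ (i, j)) $$ (i, j))"
        using Fcont by (cases "(i, j) = s") auto
    qed simp
    have h: "continuous_on {0..1} h" "\<And>t. t \<in> {0..1} \<Longrightarrow> cmod (h t) \<le> m"
      unfolding h_def using Fcont s insert.prems(4) by auto
    have F: "F = (\<lambda>t. H t + entry h a b t)"
    proof
      fix t show "F t = H t + entry h a b t"
        using Fc[of t] Fout[of t] s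
        by (cases "t \<in> {0..1}") (auto simp: H_def entry_def on_interval_def matrix_unit_def h_def intro!: eq_matI)
    qed
    have "norm (g H) \<le> m * (\<Sum>(a, b)\<in>S. 2 * norm (g (E a b)))"
    proof (rule insert.IH[OF _ H insert.prems(3)])
      fix t :: real and i j assume t: "t \<in> {0..1}" and ij: "i < k" "j < k"
      show "cmod (H t $$ (i, j)) \<le> m"
        using insert.prems(3) insert.prems(4)[OF t ij] ij t by (simp add: H_def on_interval_def)
    next
      fix t :: real and i j assume ij: "i < k" "j < k" "(i, j) \<notin> S"
      show "H t $$ (i, j) = 0"
        using insert.prems(5)[of i j t] ij by (auto simp: H_def on_interval_def)
    qed (use insert.prems(1) in simp)
    moreover have "entry h a b \<in> interval_matrices k" "norm (g (entry h a b)) \<le> m * (2 * norm (g (E a b)))"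
      using entry_bound[OF h insert.prems(3)] by auto
    moreover have "g F = g H + g (entry h a b)" by (subst F) (rule plus[OF H calculation(2)])
    ultimately show ?case
      using insert.hyps norm_triangle_ineq[of "g H" "g (entry h a b)"] s(1)
      by (simp add: distrib_left)
  qed
  show ?thesis
  proof (intro exI[of _ K] conjI ballI allI impI)
    show K: "K \<ge> 0" unfolding K_def by (intro sum_nonneg) auto
    fix F m assume F: "F \<in> interval_matrices k" and m: "m \<ge> (0::real)"
      and bd: "\<forall>t\<in>{0..1}. \<forall>i<k. \<forall>j<k. cmod (F t $$ (i, j)) \<le> m"
    have *: "norm (g F) \<le> (m + d) * K" if "d > 0" for d
      unfolding K_def
    proof (rule main[OF _ _ F])
      fix t :: real and i j assume "t \<in> {0..1}" "i < k" "j < k"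
      with bd have "cmod (F t $$ (i, j)) \<le> m" by blast
      with that show "cmod (F t $$ (i, j)) \<le> m + d" by simp
    qed (use m that in auto)
    show "norm (g F) \<le> m * K"
    proof (rule field_le_epsilon)
      fix e :: real assume e: "e > 0"
      have "norm (g F) \<le> (m + e / (K + 1)) * K" by (rule *) (use e K in simp)
      also have "\<dots> \<le> m * K + e" using e K by (simp add: distrib_right divide_simps mult_left_mono)
      finally show "norm (g F) \<le> m * K + e" .
    qed
  qed
qed

lemma interval_algebra_invertibles_dense:
  fixes B :: "'a::unital_cstar_algebra set"
  assumes "iso_interval_matrix_algebra B k" and B: "cstar_subalgebra B"
  shows "\<exists>u. is_unit_of u B \<and> invertibles_dense_in B u"
proof -
  let ?C = "interval_matrices k"
  obtain f where f: "star_isomorphism f B ?C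
      (\<lambda>F G t. F t + G t) (\<lambda>F G t. F t * G t) (\<lambda>c F t. c \<cdot>\<^sub>m F t) (\<lambda>F t. cmat_adj (F t))"
    using assms(1) unfolding iso_interval_matrix_algebra_def by blast
  obtain g where g: "\<And>F. F \<in> ?C \<Longrightarrow> g F \<in> B" "\<And>F. F \<in> ?C \<Longrightarrow> f (g F) = F"
    "\<And>x. x \<in> B \<Longrightarrow> f x \<in> ?C" "\<And>x. x \<in> B \<Longrightarrow> g (f x) = x"
    "\<And>F G. F \<in> ?C \<Longrightarrow> G \<in> ?C \<Longrightarrow> (\<lambda>t. F t + G t) \<in> ?C \<and> g (\<lambda>t. F t + G t) = g F + g G"
    "\<And>F G. F \<in> ?C \<Longrightarrow> G \<in> ?C \<Longrightarrow> (\<lambda>t. F t * G t) \<in> ?C \<and> g (\<lambda>t. F t * G t) = g F * g G"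
    "\<And>c F. F \<in> ?C \<Longrightarrow> (\<lambda>t. c \<cdot>\<^sub>m F t) \<in> ?C \<and> g (\<lambda>t. c \<cdot>\<^sub>m F t) = c *\<^sub>C g F"
    "\<And>F. F \<in> ?C \<Longrightarrow> (\<lambda>t. cmat_adj (F t)) \<in> ?C \<and> g (\<lambda>t. cmat_adj (F t)) = adj (g F)"
    by (rule star_isomorphism_inverse[OF f B]) blast
  obtain K where K: "K \<ge> 0" "\<And>F m. F \<in> ?C \<Longrightarrow> m \<ge> 0 \<Longrightarrow>
      \<forall>t\<in>{0..1}. \<forall>i<k. \<forall>j<k. cmod (F t $$ (i, j)) \<le> m \<Longrightarrow> norm (g F) \<le> m * K"
    using interval_matrix_norm_bound[of k g, OF conjunct2[OF g(5)] conjunct2[OF g(6)]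
        conjunct2[OF g(7)] conjunct2[OF g(8)]] by blast
  define one where "one = on_interval k (\<lambda>t. 1\<^sub>m k)"
  have one: "one \<in> ?C" unfolding one_def by (rule on_interval_in) auto
  define u where "u = g one"
  have "is_unit_of u B"
    unfolding is_unit_of_def
  proof (intro conjI ballI)
    show "u \<in> B" unfolding u_def by (rule g(1)[OF one])
    fix x assume x: "x \<in> B"
    have Fx: "f x t \<in> carrier_mat k k" "t \<notin> {0..1} \<Longrightarrow> f x t = 0\<^sub>m k k" for t
      using g(3)[OF x] unfolding interval_matrices_def by auto
    have "(\<lambda>t. one t * f x t) = f x" "(\<lambda>t. f x t * one t) = f x"
      using left_mult_one_mat[OF Fx(1)] right_mult_one_mat[OF Fx(1)] Fx(2)
      by (auto simp: one_def on_interval_def fun_eq_iff)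
    thus "u * x = x" "x * u = x"
      unfolding u_def using g(6)[OF one g(3)[OF x]] g(6)[OF g(3)[OF x] one] g(4)[OF x] by simp_all
  qed
  moreover have "invertibles_dense_in B u"
    unfolding invertibles_dense_in_def
  proof (intro ballI allI impI)
    fix y and e :: real assume y: "y \<in> B" and e: "e > 0"
    have e': "e / (K + 1) > 0" using e K(1) by simp
    obtain S G where S: "S \<in> ?C" "G \<in> ?C" "(\<lambda>t. S t * G t) = one" "(\<lambda>t. G t * S t) = one"
      "\<forall>t\<in>{0..1}. \<forall>i<k. \<forall>j<k. cmod (f y t $$ (i, j) - S t $$ (i, j)) < e / (K + 1)"
      using interval_matrices_approx_invertible[OF g(3)[OF y] e'] unfolding one_def by blast
    have S': "(\<lambda>t. (- 1) \<cdot>\<^sub>m S t) \<in> ?C" and gS: "g (\<lambda>t. (- 1) \<cdot>\<^sub>m S t) = - g S"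
      using g(7)[OF S(1), of "- 1"] by simp_all
    define D where "D = (\<lambda>t. f y t + (- 1) \<cdot>\<^sub>m S t)"
    have D: "D \<in> ?C" "g D = y - g S"
      using g(5)[OF g(3)[OF y] S'] gS g(4)[OF y] unfolding D_def by simp_all
    have "norm (g D) \<le> e / (K + 1) * K"
    proof (rule K(2)[OF D(1)], safe)
      fix t :: real and i j assume t: "t \<in> {0..1}" and ij: "i < k" "j < k"
      have "f y t \<in> carrier_mat k k" "S t \<in> carrier_mat k k"
        using g(3)[OF y] S(1) unfolding interval_matrices_def by auto
      hence "D t $$ (i, j) = f y t $$ (i, j) - S t $$ (i, j)" using ij by (simp add: D_def)
      thus "cmod (D t $$ (i, j)) \<le> e / (K + 1)"
        using S(5) t ij by (simp add: less_imp_le)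
    qed (use e' in simp)
    also have "\<dots> < e" using e K(1) by (simp add: field_simps)
    finally have "norm (y - g S) < e" unfolding D(2) .
    moreover have "g S * g G = u" "g G * g S = u"
      using g(6)[OF S(1,2)] g(6)[OF S(2,1)] S(3,4) unfolding u_def by simp_all
    ultimately show "\<exists>s\<in>B. \<exists>s'\<in>B. s * s' = u \<and> s' * s = u \<and> norm (y - s) < e"
      using g(1)[OF S(1)] g(1)[OF S(2)] by blast
  qed
  ultimately show ?thesis by blast
qed

lemma orthogonal_sum_mult:
  fixes b c :: "nat \<Rightarrow> 'a::ring"
  assumes "\<And>i j. i < n \<Longrightarrow> j < n \<Longrightarrow> i \<noteq> j \<Longrightarrow> b i * c j = 0"
  shows "(\<Sum>i<n. b i) * (\<Sum>j<n. c j) = (\<Sum>i<n. b i * c i)"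
proof -
  have "(\<Sum>i<n. b i) * (\<Sum>j<n. c j) = (\<Sum>i<n. \<Sum>j<n. b i * c j)" by (rule sum_product)
  also have "\<dots> = (\<Sum>i<n. \<Sum>j<n. if j = i then b i * c i else 0)"
    by (intro sum.cong refl) (use assms in auto)
  also have "\<dots> = (\<Sum>i<n. b i * c i)" by simp
  finally show ?thesis .
qed

text \<open>
  Invertible approximants are chosen in each summand; the sum of the units of the summands has to
  be \<open>p\<close>.
\<close>

lemma matrix_interval_class_invertibles_dense:
  fixes I :: "'a::unital_cstar_algebra set"
  assumes "matrix_interval_class I" and p: "is_unit_of p I"
  shows "invertibles_dense_in I p"
proof -
  obtain n B where n: "cstar_direct_sum I n B"
    "\<And>i. i < n \<Longrightarrow> \<exists>k\<ge>1. iso_matrix_algebra (B i) k \<or> iso_interval_matrix_algebra (B i) k"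
    using assms(1) unfolding matrix_interval_class_def by blast
  have B: "\<And>i. i < n \<Longrightarrow> cstar_subalgebra (B i)"
    and orth: "\<And>i j x y. i < n \<Longrightarrow> j < n \<Longrightarrow> i \<noteq> j \<Longrightarrow> x \<in> B i \<Longrightarrow> y \<in> B j \<Longrightarrow> x * y = 0"
    and I: "I = {\<Sum>i<n. b i | b. \<forall>i<n. b i \<in> B i}"
    using n(1) unfolding cstar_direct_sum_def by blast+
  have "\<exists>u. is_unit_of u (B i) \<and> invertibles_dense_in (B i) u" if "i < n" for i
    using n(2)[OF that] B[OF that] matrix_algebra_invertibles_dense interval_algebra_invertibles_dense
    by blast
  then obtain u where u: "\<And>i. i < n \<Longrightarrow> is_unit_of (u i) (B i)"
    "\<And>i. i < n \<Longrightarrow> invertibles_dense_in (B i) (u i)" by metis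
  have uB: "u i \<in> B i" if "i < n" for i using u(1)[OF that] unfolding is_unit_of_def by blast
  have unit: "(\<Sum>i<n. u i) = p"
  proof -
    have uI: "(\<Sum>i<n. u i) \<in> I" unfolding I using uB by blast
    have "p \<in> I" using p unfolding is_unit_of_def by blast
    then obtain b where b: "p = (\<Sum>i<n. b i)" "\<And>i. i < n \<Longrightarrow> b i \<in> B i" unfolding I by blast
    have "p * (\<Sum>i<n. u i) = (\<Sum>i<n. b i * u i)"
      unfolding b(1) by (rule orthogonal_sum_mult) (use b(2) uB orth in blast)
    also have "\<dots> = p"
      unfolding b(1) by (intro sum.cong refl) (use u(1) b(2) in \<open>auto simp: is_unit_of_def\<close>)
    finally show ?thesis using p uI unfolding is_unit_of_def by metis
  qed
  show ?thesis
    unfolding invertibles_dense_in_def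
  proof (intro ballI allI impI)
    fix y and e :: real assume y: "y \<in> I" and e: "e > 0"
    obtain b where b: "y = (\<Sum>i<n. b i)" "\<And>i. i < n \<Longrightarrow> b i \<in> B i" using y unfolding I by blast
    have e': "e / (real n + 1) > 0" using e by simp
    have "\<exists>s s'. s \<in> B i \<and> s' \<in> B i \<and> s * s' = u i \<and> s' * s = u i \<and> norm (b i - s) < e / (real n + 1)"
      if "i < n" for i
      using u(2)[OF that] b(2)[OF that] e' unfolding invertibles_dense_in_def by blast
    then obtain s s' where s: "\<And>i. i < n \<Longrightarrow> s i \<in> B i" "\<And>i. i < n \<Longrightarrow> s' i \<in> B i"
      "\<And>i. i < n \<Longrightarrow> s i * s' i = u i" "\<And>i. i < n \<Longrightarrow> s' i * s i = u i"
      "\<And>i. i < n \<Longrightarrow> norm (b i - s i) < e / (real n + 1)" by metis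
    have "(\<Sum>i<n. s i) * (\<Sum>i<n. s' i) = (\<Sum>i<n. s i * s' i)"
      by (rule orthogonal_sum_mult) (use s(1,2) orth in blast)
    hence 1: "(\<Sum>i<n. s i) * (\<Sum>i<n. s' i) = p" using s(3) unit by simp
    have "(\<Sum>i<n. s' i) * (\<Sum>i<n. s i) = (\<Sum>i<n. s' i * s i)"
      by (rule orthogonal_sum_mult) (use s(1,2) orth in blast)
    hence 2: "(\<Sum>i<n. s' i) * (\<Sum>i<n. s i) = p" using s(4) unit by simp
    have "norm (y - (\<Sum>i<n. s i)) \<le> (\<Sum>i<n. norm (b i - s i))"
      unfolding b(1) sum_subtractf[symmetric] by (rule norm_sum)
    also have "\<dots> \<le> (\<Sum>i<n. e / (real n + 1))" by (intro sum_mono) (use s(5) in force)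
    also have "\<dots> < e" using e by (simp add: field_simps)
    finally have "norm (y - (\<Sum>i<n. s i)) < e" .
    with 1 2 show "\<exists>s\<in>I. \<exists>s'\<in>I. s * s' = p \<and> s' * s = p \<and> norm (y - s) < e"
      using s(1,2) unfolding I by blast
  qed
qed

section \<open>Tracial approximation\<close>

lemma norm_projection_mult_le:
  fixes p :: "'a::unital_cstar_algebra"
  assumes "projection p"
  shows "norm (p * x) \<le> norm x" "norm (x * p) \<le> norm x"
  using norm_mult_ineq[of p x] norm_mult_ineq[of x p] norm_projection_le[OF assms]
    mult_right_mono[of "norm p" 1 "norm x"] mult_left_mono[of "norm p" 1 "norm x"]
  by auto

lemma projection_complement:
  fixes p :: "'a::unital_cstar_algebra"
  shows "projection p \<Longrightarrow> projection (1 - p)"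
  by (simp add: projection_def adj_diff algebra_simps)

text \<open>
  The form in which the tracial hypothesis is used below. The approximants of \<open>p * x * p\<close> are
  moved to elements that are invertible in the corner of \<open>p\<close>, and the comparison is with a square of a
  selfadjoint element, which is positive, and full by simplicity.
\<close>

lemma tracial_approximation:
  fixes F :: "'a::unital_cstar_algebra set"
  assumes simple: "simple_cstar_algebra TYPE('a)" and tai: "tracially_AI TYPE('a)"
    and F: "finite F" "b \<in> F" "b \<noteq> 0" and e: "e > 0" and h: "adj h = h" "h \<noteq> 0"
  obtains p where "projection p" "\<And>x. x \<in> F \<Longrightarrow> norm (x * p - p * x) < e"
    "\<And>x. x \<in> F \<Longrightarrow> \<exists>s s'. s * s' = p \<and> s' * s = p \<and> p * s = s \<and> s * p = s \<and> p * s' = s' \<and> s' * p = s' \<and>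
      norm (p * x * p - s) < e"
    "norm b - e \<le> norm (p * b * p)" "mvn_le_pos (1 - p) (h * h)"
proof -
  have "h * h \<noteq> 0" using h adj_mult_self_eq_zero[of h] by auto
  hence "positive_element (h * h)" "full_element (h * h)"
    using positive_element_square[OF h(1)] simple_full_element[OF simple] by auto
  hence "\<exists>p I. projection p \<and> p \<noteq> 0 \<and> cstar_subalgebra I \<and> matrix_interval_class I \<and> is_unit_of p I \<and>
      (\<forall>x\<in>F. norm (x * p - p * x) < e / 2) \<and> (\<forall>x\<in>F. \<exists>y\<in>I. norm (p * x * p - y) < e / 2) \<and>
      norm (p * b * p) \<ge> norm b - e / 2 \<and> mult_class_le 1 (1 - p) p \<and> mvn_le_pos (1 - p) (h * h)"
    using spec[OF spec[OF spec[OF spec[OF spec[OF tai[unfolded tracially_AI_def], of F], of b], of "e / 2"], of 1], of "h * h"]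
      F e by simp
  then obtain p I where p: "projection p" "matrix_interval_class I" "is_unit_of p I"
    "\<And>x. x \<in> F \<Longrightarrow> norm (x * p - p * x) < e / 2" "\<And>x. x \<in> F \<Longrightarrow> \<exists>y\<in>I. norm (p * x * p - y) < e / 2"
    "norm b - e / 2 \<le> norm (p * b * p)" "mvn_le_pos (1 - p) (h * h)"
    by blast
  have dense: "invertibles_dense_in I p"
    by (rule matrix_interval_class_invertibles_dense[OF p(2,3)])
  show thesis
  proof (rule that[OF p(1)])
    fix x assume x: "x \<in> F"
    show "norm (x * p - p * x) < e" using p(4)[OF x] e by simp
    obtain y where y: "y \<in> I" "norm (p * x * p - y) < e / 2" using p(5)[OF x] by blast
    obtain s s' where s: "s \<in> I" "s' \<in> I" "s * s' = p" "s' * s = p" "norm (y - s) < e / 2"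
      using dense y(1) e unfolding invertibles_dense_in_def by (meson half_gt_zero)
    have "norm (p * x * p - s) < e"
      using norm_triangle_ineq[of "p * x * p - y" "y - s"] y(2) s(5) by simp
    with s p(3) show "\<exists>s s'. s * s' = p \<and> s' * s = p \<and> p * s = s \<and> s * p = s \<and> p * s' = s' \<and> s' * p = s' \<and>
        norm (p * x * p - s) < e"
      unfolding is_unit_of_def by blast
  qed (use p(6,7) e in auto)
qed

text \<open>
  Suppose \<open>y * x = 1\<close> and \<open>b = 1 - x * y\<close> is not 0. Replace \<open>p * x * p\<close> by an
  element \<open>s\<close> that is invertible in the corner of \<open>p\<close>. Then \<open>y' = p * y * p\<close> is almost a
  left inverse of \<open>s\<close>, so it is close to the inverse \<open>s'\<close>, whose norm is therefore under control,
  and \<open>s * y'\<close> is close to \<open>p\<close> too. Thus \<open>p * b * p\<close> is small, although its norm is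
  at least \<open>norm b - e\<close>.
\<close>

lemma tracially_AI_finite:
  fixes x y :: "'a::unital_cstar_algebra"
  assumes simple: "simple_cstar_algebra TYPE('a)" and tai: "tracially_AI TYPE('a)"
    and yx: "y * x = 1"
  shows "x * y = 1"
proof (rule ccontr)
  assume "x * y \<noteq> 1"
  define b where "b = 1 - x * y"
  have b: "b \<noteq> 0" using \<open>x * y \<noteq> 1\<close> unfolding b_def by simp
  (* The estimate at the end of the proof bounds norm b by e * C. *)
  define C where "C = 4 * (norm x + 1) * (norm y)\<^sup>2 + 2 * norm y + 1"
  have C: "C > 0" unfolding C_def by (intro add_nonneg_pos) auto
  define e where "e = min 1 (min (1 / (4 * (norm y + 1))) (norm b / (2 * C)))"
  have e0: "e > 0" using b C unfolding e_def by (auto intro: add_nonneg_pos)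
  have e1: "e \<le> 1" unfolding e_def by simp
  have "e \<le> 1 / (4 * (norm y + 1))" unfolding e_def by simp
  hence "e * (4 * (norm y + 1)) \<le> 1" by (subst (asm) pos_le_divide_eq) (auto intro: add_nonneg_pos)
  hence e2: "2 * e * norm y \<le> 1 / 2" using e0 by (simp add: algebra_simps)
  have "e \<le> norm b / (2 * C)" unfolding e_def by simp
  hence "e * (2 * C) \<le> norm b" using C by (subst (asm) pos_le_divide_eq) auto
  moreover have "e * C < e * (2 * C)" using e0 C by simp
  ultimately have e3: "e * C < norm b" by linarith
  obtain p where p: "projection p" "norm (x * p - p * x) < e"
    "\<exists>s s'. s * s' = p \<and> s' * s = p \<and> p * s = s \<and> s * p = s \<and> p * s' = s' \<and> s' * p = s' \<and> norm (p * x * p - s) < e"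
    "norm b - e \<le> norm (p * b * p)"
    by (rule tracial_approximation[OF simple tai, of "{b, x}" b e 1]) (use b e0 in auto)
  then obtain s s' where s: "s * s' = p" "s' * s = p" "p * s = s" "s * p = s" "p * s' = s'" "s' * p = s'"
    "norm (p * x * p - s) < e" by blast
  note pn = norm_projection_mult_le[OF p(1)]
  have pp: "p * p = p" using p(1) unfolding projection_def by blast
  have pp': "p * (p * a) = p * a" for a using pp by (simp flip: mult.assoc)
  define y' where "y' = p * y * p"
  have y': "norm y' \<le> norm y" unfolding y'_def using pn(1)[of "y"] pn(2)[of "p * y"] by linarith
  define \<kappa> where "\<kappa> = p - y' * s"
  have "p * y * (x * p) = p" using yx by (simp add: mult.assoc pp flip: mult.assoc[of y x p])
  hence \<kappa>: "\<kappa> = p * y * (x * p - p * x) * p + y' * (p * x * p - s)"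
    unfolding \<kappa>_def y'_def by (simp add: algebra_simps pp pp') 
  have pyx: "norm (p * y * (x * p - p * x) * p) \<le> norm y * e"
  proof -
    have "norm (p * y * (x * p - p * x) * p) \<le> norm (p * (y * (x * p - p * x)))"
      using pn(2)[of "p * y * (x * p - p * x)"] by (simp add: mult.assoc)
    also have "\<dots> \<le> norm (y * (x * p - p * x))" by (rule pn(1))
    also have "\<dots> \<le> norm y * e"
      using p(2) by (intro order_trans[OF norm_mult_ineq] mult_left_mono) auto
    finally show ?thesis .
  qed
  have ys: "norm (y' * (p * x * p - s)) \<le> norm y * e"
    using y' s(7) e0 by (intro order_trans[OF norm_mult_ineq] mult_mono) auto
  have sy: "norm ((p * x * p - s) * y') \<le> e * norm y"
    using y' s(7) e0 by (intro order_trans[OF norm_mult_ineq] mult_mono) auto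
  have kn: "norm \<kappa> \<le> 2 * e * norm y"
  proof -
    have "2 * e * norm y = norm y * e + norm y * e" by simp
    with pyx ys show ?thesis
      unfolding \<kappa> using norm_triangle_ineq[of "p * y * (x * p - p * x) * p" "y' * (p * x * p - s)"]
      by linarith
  qed
  have y's: "y' = s' - \<kappa> * s'"
  proof -
    have "y' = y' * (s * s')" unfolding s(1) y'_def by (simp add: mult.assoc pp)
    also have "\<dots> = (p - \<kappa>) * s'" unfolding \<kappa>_def by (simp add: mult.assoc)
    finally show ?thesis by (simp add: left_diff_distrib s(5))
  qed
  have s'n: "norm s' \<le> 2 * norm y"
  proof -
    have "norm (\<kappa> * s') \<le> (1 / 2) * norm s'"
      using kn e2 by (intro order_trans[OF norm_mult_ineq] mult_right_mono) auto
    moreover have "norm s' \<le> norm y' + norm (\<kappa> * s')"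
      using norm_triangle_ineq[of y' "\<kappa> * s'"] y's by simp
    ultimately show ?thesis using y' by simp
  qed
  have sn: "norm s \<le> norm x + 1"
  proof -
    have "norm (p * x * p) \<le> norm x" using pn(2)[of "p * x"] pn(1)[of x] by linarith
    moreover have "norm s \<le> norm (p * x * p) + norm (p * x * p - s)"
      using norm_triangle_ineq4[of "p * x * p" "p * x * p - s"] by simp
    ultimately show ?thesis using s(7) e1 by linarith
  qed
  have "p - s * y' = s * \<kappa> * s'" unfolding y's by (simp add: right_diff_distrib s(1) mult.assoc)
  moreover have "norm (s * \<kappa> * s') \<le> (norm x + 1) * (2 * e * norm y) * (2 * norm y)"
    by (intro order_trans[OF norm_mult_ineq] mult_mono sn kn s'n)
      (use e0 in \<open>auto intro: add_nonneg_nonneg\<close>)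
  ultimately have A: "norm (p - s * y') \<le> (norm x + 1) * (2 * e * norm y) * (2 * norm y)" by simp
  have B: "norm (p * (x * p - p * x) * y * p) \<le> e * norm y"
  proof -
    have "norm (p * (x * p - p * x) * y * p) \<le> norm (p * ((x * p - p * x) * y))"
      using pn(2)[of "p * (x * p - p * x) * y"] by (simp add: mult.assoc)
    also have "\<dots> \<le> norm ((x * p - p * x) * y)" by (rule pn(1))
    also have "\<dots> \<le> e * norm y"
      using p(2) by (intro order_trans[OF norm_mult_ineq] mult_right_mono) auto
    finally show ?thesis .
  qed
  have "p * b * p = (p - s * y') - (p * x * p - s) * y' + p * (x * p - p * x) * y * p"
    unfolding b_def y'_def by (simp add: algebra_simps pp pp')
  hence "norm (p * b * p) \<le> norm (p - s * y') + norm ((p * x * p - s) * y') + norm (p * (x * p - p * x) * y * p)"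
    using norm_triangle_ineq[of "(p - s * y') - (p * x * p - s) * y'" "p * (x * p - p * x) * y * p"]
      norm_triangle_ineq4[of "p - s * y'" "(p * x * p - s) * y'"] by simp
  also have "\<dots> \<le> (norm x + 1) * (2 * e * norm y) * (2 * norm y) + e * norm y + e * norm y"
    by (intro add_mono A B sy)
  finally have "norm b \<le> e * C"
    using p(4) unfolding C_def by (simp add: algebra_simps power2_eq_square)
  with e3 show False by simp
qed

text \<open>
  If the tracial approximation of \<open>x\<close> had \<open>p = 1\<close>, it would provide invertible elements close to
  \<open>x\<close>. So \<open>1 - p\<close> is a nonzero projection, and it is equivalent to a subprojection of one
  in the hereditary subalgebra generated by \<open>h * h\<close>.
\<close>

lemma nonzero_projection_in_hereditary_subalgebra:
  fixes x h :: "'a::unital_cstar_algebra"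
  assumes simple: "simple_cstar_algebra TYPE('a)" and tai: "tracially_AI TYPE('a)"
    and x: "x \<notin> closure {x. invertible_element x}" and h: "adj h = h" "h \<noteq> 0"
  obtains r where "projection r" "r \<noteq> 0" "r \<in> closure (range (\<lambda>y. (h * h) * y * (h * h)))"
proof -
  obtain e where e: "e > 0" "\<And>y. invertible_element y \<Longrightarrow> \<not> dist y x < e"
    using x unfolding closure_approachable by blast
  obtain p where p: "projection p"
    "\<exists>s s'. s * s' = p \<and> s' * s = p \<and> p * s = s \<and> s * p = s \<and> p * s' = s' \<and> s' * p = s' \<and> norm (p * x * p - s) < e"
    "mvn_le_pos (1 - p) (h * h)"
    by (rule tracial_approximation[OF simple tai, of "{1, x}" 1 e h]) (use h e in auto)
  have "p \<noteq> 1"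
  proof
    assume "p = 1"
    with p(2) obtain s s' where "s * s' = 1" "s' * s = 1" "norm (x - s) < e" by auto
    with e(2)[of s] show False unfolding invertible_element_def by (auto simp: dist_norm norm_minus_commute)
  qed
  obtain r where r: "projection r" "r \<in> closure (range (\<lambda>y. (h * h) * y * (h * h)))" "mvn_le (1 - p) r"
    using p(3) unfolding mvn_le_pos_def by blast
  have "r \<noteq> 0"
  proof
    assume "r = 0"
    with r(3) obtain v where v: "adj v * v = 1 - p" "v * adj v = 0"
      unfolding mvn_le_def mvn_equiv_def by auto
    have "adj v = 0" by (rule adj_mult_self_eq_zero) (simp add: adj_adj v)
    with v(1) \<open>p \<noteq> 1\<close> show False by simp
  qed
  with r show thesis by (intro that)
qed

text \<open>
  For a projection \<open>r\<close> the comparison \<open>q \<preceq> r\<close> is given by a partial isometry between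
  \<open>q\<close> and a subprojection of \<open>r\<close>.
\<close>

lemma mvn_le_pos_projection:
  fixes p r :: "'a::unital_cstar_algebra"
  assumes p: "projection p" and r: "projection r" and le: "mvn_le_pos (1 - p) (r * r)"
  obtains t where "adj t * t = 1 - p" "t * p = 0" "p * adj t = 0" "r * t = t" "adj t * r = adj t"
proof -
  have rr: "r * r = r" "adj r = r" and pp: "p * p = p" "adj p = p" using r p unfolding projection_def by auto
  obtain q1 where q1: "projection q1" "q1 \<in> closure (range (\<lambda>y. r * y * r))" "mvn_le (1 - p) q1"
    using le unfolding mvn_le_pos_def rr by blast
  have "closure (range (\<lambda>y. r * y * r)) \<subseteq> {y. r * y = y}"
  proof (rule closure_minimal)
    show "closed {y. r * y = y}" by (intro closed_Collect_eq continuous_intros)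
  qed (auto simp: rr simp flip: mult.assoc)
  with q1(2) have rq1: "r * q1 = q1" by blast
  obtain q' t where t: "projection q'" "q' \<in> range (\<lambda>y. q1 * y * q1)" "adj t * t = 1 - p" "t * adj t = q'"
    using q1(3) unfolding mvn_le_def mvn_equiv_def by blast
  have rq': "r * q' = q'" using t(2) rq1 by (auto simp flip: mult.assoc)
  have aq': "adj q' = q'" using t(1) unfolding projection_def by blast
  have q'r: "q' * r = q'" using arg_cong[OF rq', of adj] by (simp add: adj_mult aq' rr)
  have "(t - r * t) * (adj t - adj t * r) = t * adj t - t * adj t * r - r * (t * adj t) + r * (t * adj t) * r"
    by (simp add: algebra_simps)
  also have "\<dots> = 0" unfolding t(4) by (simp add: rq' q'r)
  finally have "adj (adj t - adj t * r) * (adj t - adj t * r) = 0"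
    by (simp add: adj_diff adj_mult adj_adj rr)
  from adj_mult_self_eq_zero[OF this] have tr: "adj t * r = adj t" by simp
  have rt: "r * t = t" using arg_cong[OF tr, of adj] by (simp add: adj_mult adj_adj rr)
  have "adj (t * p) * (t * p) = p * (adj t * t) * p" by (simp add: adj_mult pp mult.assoc)
  also have "\<dots> = 0" unfolding t(3) by (simp add: algebra_simps pp)
  finally have tp: "t * p = 0" by (rule adj_mult_self_eq_zero)
  have "p * adj t = 0" using arg_cong[OF tp, of adj] by (simp add: adj_mult pp)
  with tp tr rt t(3) show thesis by (intro that)
qed

text \<open>
  Up to a small error \<open>X\<close> is \<open>s + w\<close> with \<open>s\<close> invertible in the corner of \<open>p\<close> and \<open>w\<close> in that of \<open>1 - p\<close>,
  and \<open>s + w = (s + (1 - p)) * (p + w)\<close>.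
\<close>

lemma tracial_factorization:
  fixes X r :: "'a::unital_cstar_algebra"
  assumes simple: "simple_cstar_algebra TYPE('a)" and tai: "tracially_AI TYPE('a)"
    and r: "projection r" "r \<noteq> 0" and e: "e > 0"
  obtains p w g g' t where "norm (X - g * (p + w)) < e" "g * g' = 1"
    "p * p = p" "w * p = 0" "p * w = 0"
    "adj t * t = 1 - p" "t * p = 0" "p * adj t = 0" "r * t = t" "adj t * r = adj t"
proof -
  have rr: "adj r = r" using r unfolding projection_def by blast
  have e3: "e / 3 > 0" using e by simp
  obtain p where p: "projection p" "norm (X * p - p * X) < e / 3"
    "\<exists>s s'. s * s' = p \<and> s' * s = p \<and> p * s = s \<and> s * p = s \<and> p * s' = s' \<and> s' * p = s' \<and> norm (p * X * p - s) < e / 3"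
    "mvn_le_pos (1 - p) (r * r)"
    by (rule tracial_approximation[OF simple tai, of "{1, X}" 1 "e / 3" r]) (use rr r e3 in auto)
  then obtain s s' where s: "s * s' = p" "s' * s = p" "p * s = s" "s * p = s" "p * s' = s'" "s' * p = s'"
    "norm (p * X * p - s) < e / 3" by blast
  obtain t where t: "adj t * t = 1 - p" "t * p = 0" "p * adj t = 0" "r * t = t" "adj t * r = adj t"
    using mvn_le_pos_projection[OF p(1) r(1) p(4)] by blast
  have pp: "p * p = p" using p(1) unfolding projection_def by blast
  have pp': "p * (p * a) = p * a" for a using pp by (simp flip: mult.assoc)
  define q where "q = 1 - p"
  have pq: "p * q = 0" "q * p = 0" "q * q = q" unfolding q_def by (simp_all add: algebra_simps pp)
  have sq: "s * q = 0" "q * s' = 0" unfolding q_def by (simp_all add: algebra_simps s)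
  have sq': "s * (q * a) = 0" "p * (q * a) = 0" "q * (q * a) = q * a" for a
    using sq pq by (simp_all flip: mult.assoc)
  define w where "w = q * X * q"
  have gm: "(s + q) * (p + w) = s + w"
    unfolding w_def by (simp add: distrib_left distrib_right mult.assoc sq' pq s(4))
  show thesis
  proof (rule that[of "s + q" p w "s' + q" t])
    show "(s + q) * (s' + q) = 1"
      by (simp add: distrib_left distrib_right s(1) sq pq) (simp add: q_def)
    show "w * p = 0" "p * w = 0" unfolding w_def by (simp_all add: mult.assoc pq sq')
    have split: "X - (s + w) = (p * X * p - s) - p * (X * p - p * X) * q + q * (X * p - p * X) * p"
      unfolding w_def q_def by (simp add: algebra_simps pp pp')
    have "norm (p * (X * p - p * X) * q) \<le> norm (X * p - p * X)"
      "norm (q * (X * p - p * X) * p) \<le> norm (X * p - p * X)"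
      using norm_projection_mult_le[OF p(1)] norm_projection_mult_le[OF projection_complement[OF p(1)]]
      unfolding q_def by (blast intro: order_trans)+
    thus "norm (X - (s + q) * (p + w)) < e"
      unfolding gm split
      using norm_triangle_ineq[of "(p * X * p - s) - p * (X * p - p * X) * q" "q * (X * p - p * X) * p"]
        norm_triangle_ineq4[of "p * X * p - s" "p * (X * p - p * X) * q"] s(7) p(2) by linarith
  qed (use pp t in auto)
qed

section \<open>Stable rank one\<close>

text \<open>
  Here \<open>v\<close> and \<open>v'\<close> give an equivalence between \<open>r\<close>, which annihilates \<open>x\<close> from the right, and the
  idempotent \<open>v * v'\<close>, which annihilates \<open>x\<close> from the left. A tracial approximation \<open>z\<close> of \<open>X = x + v\<close> has an
  almost known corner near \<open>v\<close>; removing it by a Schur complement gives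
  \<open>z - z * (j * v') * z\<close>, which tends to \<open>X - X * v' * X = X - v = x\<close>. The removal frees the room of
  \<open>r\<close>, into which \<open>1 - p\<close> embeds.
\<close>

lemma annihilated_in_closure_of_invertibles:
  fixes x r v v' :: "'a::unital_cstar_algebra"
  assumes simple: "simple_cstar_algebra TYPE('a)" and tai: "tracially_AI TYPE('a)"
    and r: "projection r" "r \<noteq> 0" "v' * v = r" "v * r = v" "r * v' = v'"
    and x: "x * r = 0" "v' * x = 0"
  shows "x \<in> closure {x. invertible_element x}"
proof -
  let ?S = "closure {x::'a. invertible_element x}"
  have rr: "r * r = r" using r unfolding projection_def by blast
  define X where "X = x + v"
  have v'X: "v' * X = r" unfolding X_def by (simp add: distrib_left x r)
  have approx: "\<exists>z j. norm (X - z) \<le> \<delta> \<and> norm (j - r) \<le> 2 * \<delta> \<and> z - z * (j * v') * z \<in> ?S"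
    if \<delta>: "0 < \<delta>" "\<delta> \<le> 1 / 2" for \<delta>
  proof -
    have c: "norm v' + 1 > 0" by (simp add: add_nonneg_pos)
    hence "\<delta> / (norm v' + 1) > 0" using \<delta> by simp
    then obtain p w g g' t where z: "norm (X - g * (p + w)) < \<delta> / (norm v' + 1)" "g * g' = 1"
      "p * p = p" "w * p = 0" "p * w = 0"
      "adj t * t = 1 - p" "t * p = 0" "p * adj t = 0" "r * t = t" "adj t * r = adj t"
      using tracial_factorization[OF simple tai r(1,2)] by metis
    define z where "z = g * (p + w)"
    have "norm (X - z) * (norm v' + 1) < \<delta>"
      using z(1) c unfolding z_def by (simp add: pos_less_divide_eq)
    hence Xz: "norm (X - z) + norm (X - z) * norm v' < \<delta>" by (simp add: algebra_simps)
    define u where "u = 1 - r + v' * z * r"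
    have "1 - u = v' * (X - z) * r" unfolding u_def by (simp add: right_diff_distrib left_diff_distrib v'X rr)
    hence "norm (1 - u) \<le> norm (v' * (X - z))"
      using norm_projection_mult_le(2)[OF r(1)] by simp
    also have "\<dots> \<le> norm (X - z) * norm v'" using norm_mult_ineq by (simp add: mult.commute)
    finally have un: "norm (1 - u) \<le> \<delta>" using Xz norm_ge_zero[of "X - z"] by linarith
    hence "norm (1 - u) < 1" using \<delta> by simp
    then obtain \<omega> where \<omega>: "u * \<omega> = 1" "\<omega> * u = 1" "norm \<omega> \<le> 1 / (1 - norm (1 - u))"
      using invertible_element_near_one by blast
    have "1 / (1 - norm (1 - u)) \<le> 1 / (1 / 2)" using un \<delta> by (intro divide_left_mono) auto
    hence \<omega>n: "norm \<omega> \<le> 2" using \<omega>(3) by simp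
    have ru: "r * u = v' * z * r" "u * r = v' * z * r"
      unfolding u_def using r rr
      by (simp_all add: distrib_left distrib_right left_diff_distrib right_diff_distrib mult.assoc)
        (simp flip: mult.assoc add: r)
    have \<omega>r: "\<omega> * r = r * \<omega>" by (rule commutes_with_inverse[OF \<omega>(1,2)]) (simp add: ru)
    define j where "j = r * \<omega>"
    have rj: "r * j = j" unfolding j_def by (simp add: rr flip: mult.assoc)
    have jr: "j * r = j" unfolding j_def by (simp add: mult.assoc \<omega>r) (simp add: rr flip: mult.assoc)
    have jz: "j * (v' * z * r) = r"
      unfolding ru(2)[symmetric] j_def using \<omega>(2) by (simp add: mult.assoc) (simp add: rr flip: mult.assoc)
    have "j - r = r * (\<omega> * (1 - u))" unfolding j_def by (simp add: right_diff_distrib \<omega>)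
    hence "norm (j - r) \<le> norm (\<omega> * (1 - u))" using norm_projection_mult_le(1)[OF r(1)] by simp
    also have "\<dots> \<le> 2 * \<delta>" using \<omega>n un by (intro order_trans[OF norm_mult_ineq] mult_mono) auto
    finally have jn: "norm (j - r) \<le> 2 * \<delta>" .
    have "z - z * (j * v') * z \<in> ?S"
      by (rule schur_complement_in_closure_of_invertibles[OF tracially_AI_finite[OF simple tai] z_def z(2-10)
            rr r(3-5) rj jr jz])
    moreover have "norm (X - z) \<le> \<delta>"
      using Xz mult_nonneg_nonneg[OF norm_ge_zero[of "X - z"] norm_ge_zero[of v']] by linarith
    ultimately show ?thesis using jn by blast
  qed
  have "\<exists>z j. norm (X - z) \<le> 1 / real (n + 2) \<and> norm (j - r) \<le> 2 * (1 / real (n + 2)) \<and>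
      z - z * (j * v') * z \<in> ?S" for n by (rule approx) auto
  then obtain z j where zj: "\<And>n. norm (X - z n) \<le> 1 / real (n + 2)"
    "\<And>n. norm (j n - r) \<le> 2 * (1 / real (n + 2))" "\<And>n. z n - z n * (j n * v') * z n \<in> ?S"
    by metis
  have lim: "(\<lambda>n. 1 / real (n + 2)) \<longlonglongrightarrow> 0" by (rule LIMSEQ_ignore_initial_segment[OF lim_1_over_n])
  have z: "z \<longlonglongrightarrow> X"
    by (rule LIM_zero_cancel, rule Lim_null_comparison[OF _ lim])
      (use zj(1) in \<open>simp add: norm_minus_commute\<close>)
  have j: "j \<longlonglongrightarrow> r"
    by (rule LIM_zero_cancel, rule Lim_null_comparison[OF _ tendsto_mult_right_zero[OF lim, of 2]])
      (use zj(2) in simp)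
  have "(\<lambda>n. z n - z n * (j n * v') * z n) \<longlonglongrightarrow> X - X * (r * v') * X"
    by (intro tendsto_intros z j)
  moreover have "X - X * (r * v') * X = x"
    unfolding r(5) mult.assoc v'X unfolding X_def by (simp add: distrib_right x r)
  ultimately have "(\<lambda>n. z n - z n * (j n * v') * z n) \<longlonglongrightarrow> x" by simp
  with zj(3) show ?thesis by (meson closed_closure closed_sequentially)
qed

theorem theorem4p5:
  assumes "simple_cstar_algebra TYPE('a::unital_cstar_algebra)"
    and "tracially_AI TYPE('a)"
  shows "stable_rank_one TYPE('a)"
proof (rule ccontr)
  note simple = assms(1) and tai = assms(2)
  note finite = tracially_AI_finite[OF simple tai]
  let ?S = "closure {x::'a. invertible_element x}"
  assume "\<not> stable_rank_one TYPE('a)"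
  then obtain y :: 'a where y: "y \<notin> ?S" unfolding stable_rank_one_def by blast
  have notinv: "\<not> invertible_element y" using y subsetD[OF closure_subset, of y] by blast
  have left: "\<nexists>a. a * y = 1" using notinv finite unfolding invertible_element_def by blast
  have right: "\<nexists>a. a * adj y = 1"
  proof
    assume "\<exists>a. a * adj y = 1"
    then obtain a where "a * adj y = 1" by blast
    from arg_cong[OF this, of adj] have "y * adj a = 1" by (simp add: adj_mult adj_adj)
    with finite left show False by blast
  qed
  obtain e where e: "e > 0" "ball y e \<subseteq> - ?S"
    using y open_contains_ball[of "- ?S"] by (metis ComplI closed_closure open_Compl)
  have e4: "e / 4 > 0" using e by simp
  (* Cutting y down on both sides by projections on which it is small gives an element x that is
     still outside of the closure. *)
  obtain r1 where r1: "projection r1" "r1 \<noteq> 0" "norm (y * r1) \<le> e / 4"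
    using small_on_hereditary_subalgebra[OF left e4]
      nonzero_projection_in_hereditary_subalgebra[OF simple tai y] by metis
  obtain r2 where r2: "projection r2" "r2 \<noteq> 0" "norm (adj y * r2) \<le> e / 4"
    using small_on_hereditary_subalgebra[OF right e4]
      nonzero_projection_in_hereditary_subalgebra[OF simple tai y] by metis
  have rr: "r1 * r1 = r1" "r2 * r2 = r2" "adj r2 = r2" using r1 r2 unfolding projection_def by auto
  have r2': "norm (r2 * y) \<le> e / 4"
    using r2(3) norm_adj[of "adj y * r2"] by (simp add: adj_mult adj_adj rr)
  define x where "x = (1 - r2) * y * (1 - r1)"
  have "y - x = r2 * y + y * r1 - r2 * (y * r1)" unfolding x_def by (simp add: algebra_simps)
  hence "norm (y - x) \<le> norm (r2 * y) + norm (y * r1) + norm (r2 * (y * r1))"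
    using norm_triangle_ineq4[of "r2 * y + y * r1" "r2 * (y * r1)"] norm_triangle_ineq[of "r2 * y" "y * r1"]
    by simp
  hence "norm (y - x) < e"
    using r1(3) r2' norm_projection_mult_le(1)[OF r2(1), of "y * r1"] e(1) by simp
  hence x: "x \<notin> ?S" using e(2) by (auto simp: dist_norm)
  have xr: "x * r1 = 0" "r2 * x = 0"
    unfolding x_def by (simp add: mult.assoc left_diff_distrib rr, simp add: right_diff_distrib rr flip: mult.assoc)
  obtain a where a: "r1 * a * r2 \<noteq> 0" using simple_prime[OF simple r1(2) r2(2)] by blast
  define c where "c = r1 * a * r2"
  have c: "c \<noteq> 0" "x * c = 0" "c * x = 0"
  proof -
    show "c \<noteq> 0" unfolding c_def by (rule a)
    show "x * c = 0" unfolding c_def using xr(1) by (simp flip: mult.assoc)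
    show "c * x = 0" unfolding c_def using xr(2) by (simp add: mult.assoc)
  qed
  (* From the single element c that x annihilates on both sides come a projection r with
     x * r = 0 and, by inverting an element of its corner, an equivalent idempotent v * v'
     with (v * v') * x = 0. *)
  define h where "h = c * adj c"
  have "adj c \<noteq> 0" using c(1) norm_adj[of c] by (metis norm_eq_zero)
  hence h: "adj h = h" "h \<noteq> 0"
    unfolding h_def using adj_mult_self_eq_zero[of "adj c"] by (auto simp: adj_mult adj_adj)
  obtain r where r: "projection r" "r \<noteq> 0" "r \<in> closure (range (\<lambda>y. (h * h) * y * (h * h)))"
    using nonzero_projection_in_hereditary_subalgebra[OF simple tai y h] by blast
  have rr: "r * r = r" using r unfolding projection_def by blast
  have "closure (range (\<lambda>y. (h * h) * y * (h * h))) \<subseteq> {y. x * y = 0}"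
  proof (rule closure_minimal)
    show "closed {y. x * y = 0}" by (intro closed_Collect_eq continuous_intros)
  qed (auto simp: h_def c simp flip: mult.assoc)
  with r(3) have xr: "x * r = 0" by blast
  have "\<forall>e>0. \<exists>y\<in>range (\<lambda>y. (h * h) * y * (h * h)). dist y r < e"
    using r(3) unfolding closure_approachable .
  hence "\<exists>y\<in>range (\<lambda>y. (h * h) * y * (h * h)). dist y r < 1" by (rule allE[of _ 1]) simp
  then obtain k where k: "dist ((h * h) * k * (h * h)) r < 1" by auto
  define b where "b = (h * h) * k * (h * h)"
  define u where "u = 1 - r + r * b * r"
  have "1 - u = r * (r - b) * r" unfolding u_def by (simp add: algebra_simps rr)
  hence "norm (1 - u) \<le> norm (r - b)"
    using norm_projection_mult_le(2)[OF r(1), of "r * (r - b)"] norm_projection_mult_le(1)[OF r(1), of "r - b"]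
    by simp
  hence "norm (1 - u) < 1" using k unfolding b_def by (simp add: dist_norm norm_minus_commute)
  then obtain w where w: "u * w = 1" using invertible_element_near_one by blast
  have "r * u = r * b * r" unfolding u_def
    by (simp add: distrib_left right_diff_distrib rr flip: mult.assoc)
  hence rb: "r * b * r * w = r" using w by (metis mult.assoc mult_1_right)
  define v where "v = adj c * h * k * (h * h) * r * w * r"
  define v' where "v' = r * c"
  have "v' * v = r * b * r * w * r" unfolding v_def v'_def b_def by (simp add: h_def mult.assoc)
  hence "v' * v = r" by (simp add: rb rr)
  moreover have "v * r = v" "r * v' = v'" unfolding v_def v'_def by (simp add: mult.assoc rr, simp add: rr flip: mult.assoc)
  moreover have "v' * x = 0" unfolding v'_def by (simp add: mult.assoc c)
  ultimately have "x \<in> ?S"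
    using annihilated_in_closure_of_invertibles[OF simple tai r(1,2) _ _ _ xr] by blast
  with x show False by contradiction
qed

end
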